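(* Let $e_1,\dots,e_p$ be unit vectors in $\mathbb{C}^m$ and $f_1,\dots,f_p$ unit vectors in $\mathbb{C}^n$, with $f_1,\dots,f_p$ linearly independent. Order them so that $[e_1],\dots,[e_q]$ are distinct and for each $i>q$, $[e_i]$ equals one of $[e_1],\dots,[e_q]$. For $1\le i\le q$ let $F_i$ be the face of $S$ generated by $\{\omega_{e_j\otimes f_j}:1\le j\le p,\ [e_j]=[e_i]\}$. Then each $F_i$ is also a face of $K$, and $F_i$ is affinely isomorphic to the state space of $\mathcal{B}(L_i)$, where $L_i=e_i\otimes\operatorname{Span}\{f_j:[e_j]=[e_i]\}$. Moreover the face $F$ of $S$ generated by $\{\omega_{e_i\otimes f_i}:1\le i\le p\}$ is the direct convex sum of $F_1,\dots,F_q$. In the special case where $[e_1],\dots,[e_p]$ are all distinct, $F$ is the convex hull of $\{\omega_{e_i\otimes f_i}:1\le i\le p\}$ and $F$ is a simplex.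
   Context: $K$ is the state space of $\mathcal{B}(\mathbb{C}^m\otimes\mathbb{C}^n)\cong\mathcal{B}(\mathbb{C}^m)\otimes\mathcal{B}(\mathbb{C}^n)$ and $S\subseteq K$ is the convex set of separable states (convex combinations of pure product states $\omega_{x\otimes y}$, where $\omega_z(A)=(Az,z)$ for a unit vector $z$). $[x]$ is the line spanned by $x$. The face generated by a subset is the smallest face containing it. A convex set $C$ is the direct convex sum of convex subsets $C_1,\dots,C_q$ if each point of $C$ has a unique expression $\sum_{i\in I}\lambda_i\omega_i$ with $I\subseteq\{1,\dots,q\}$, $\lambda_i>0$, $\sum\lambda_i=1$, $\omega_i\in C_i$; a simplex is a direct convex sum of finitely many points. *)

theory Defs
  imports "HOL-Analysis.Analysis"
begin

definition cinner :: "complex^'k \<Rightarrow> complex^'k \<Rightarrow> complex" where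
  "cinner x y = (\<Sum>k\<in>UNIV. x $ k * cnj (y $ k))"

definition unit_vec :: "complex^'k \<Rightarrow> bool" where
  "unit_vec x \<longleftrightarrow> cinner x x = 1"

definition cline :: "complex^'k \<Rightarrow> (complex^'k) set" where
  "cline x = range (\<lambda>c::complex. c *s x)"

definition cspan_fam :: "nat set \<Rightarrow> (nat \<Rightarrow> complex^'k) \<Rightarrow> (complex^'k) set" where
  "cspan_fam J v = {(\<Sum>j\<in>J. c j *s v j) | c. True}"

definition clin_indep :: "nat \<Rightarrow> (nat \<Rightarrow> complex^'k) \<Rightarrow> bool" where
  "clin_indep p v \<longleftrightarrow>
     (\<forall>c. (\<Sum>j\<in>{1..p}. c j *s v j) = 0 \<longrightarrow> (\<forall>j\<in>{1..p}. c j = 0))"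

definition tens :: "complex^'m \<Rightarrow> complex^'n \<Rightarrow> complex^('m \<times> 'n)" where
  "tens x y = (\<chi> k. x $ fst k * y $ snd k)"

text \<open>B(L) for a subspace L of C^k: the complex-linear maps L -> L, represented
  extensionally (value 0 outside L). For L = UNIV this is B(C^k).\<close>
definition bops :: "(complex^'k) set \<Rightarrow> (complex^'k \<Rightarrow> complex^'k) set" where
  "bops L = {T. (\<forall>x\<in>L. \<forall>y\<in>L. T (x + y) = T x + T y)
              \<and> (\<forall>c. \<forall>x\<in>L. T (c *s x) = c *s T x)
              \<and> (\<forall>x\<in>L. T x \<in> L)
              \<and> (\<forall>x. x \<notin> L \<longrightarrow> T x = 0)}"

definition idop :: "(complex^'k) set \<Rightarrow> complex^'k \<Rightarrow> complex^'k" where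
  "idop L = (\<lambda>x. if x \<in> L then x else 0)"

definition pos_op :: "(complex^'k) set \<Rightarrow> (complex^'k \<Rightarrow> complex^'k) \<Rightarrow> bool" where
  "pos_op L A \<longleftrightarrow> (\<forall>x\<in>L. Im (cinner (A x) x) = 0 \<and> Re (cinner (A x) x) \<ge> 0)"

type_synonym 'k functional = "(complex^'k \<Rightarrow> complex^'k) \<Rightarrow> complex"

text \<open>State space of B(L): positive, unital, complex-linear functionals on B(L)
  (represented extensionally: value 0 off B(L)).\<close>
definition states :: "(complex^'k) set \<Rightarrow> 'k functional set" where
  "states L = {\<omega>. (\<forall>A. A \<notin> bops L \<longrightarrow> \<omega> A = 0)
     \<and> (\<forall>A\<in>bops L. \<forall>B\<in>bops L. \<omega> (\<lambda>x. A x + B x) = \<omega> A + \<omega> B)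
     \<and> (\<forall>c. \<forall>A\<in>bops L. \<omega> (\<lambda>x. c *s A x) = c * \<omega> A)
     \<and> (\<forall>A\<in>bops L. pos_op L A \<longrightarrow> Im (\<omega> A) = 0 \<and> Re (\<omega> A) \<ge> 0)
     \<and> \<omega> (idop L) = 1}"

definition vstate :: "complex^'k \<Rightarrow> 'k functional" where
  "vstate z = (\<lambda>A. if A \<in> bops UNIV then cinner (A z) z else 0)"

definition Kst :: "('m::finite \<times> 'n::finite) functional set" where
  "Kst = states UNIV"

definition ccomb :: "real \<Rightarrow> ('a \<Rightarrow> 'b::real_vector) \<Rightarrow> ('a \<Rightarrow> 'b) \<Rightarrow> 'a \<Rightarrow> 'b" where
  "ccomb t x y = (\<lambda>a. t *\<^sub>R x a + (1 - t) *\<^sub>R y a)"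

definition fconvex :: "('a \<Rightarrow> 'b::real_vector) set \<Rightarrow> bool" where
  "fconvex C \<longleftrightarrow> (\<forall>x\<in>C. \<forall>y\<in>C. \<forall>t\<in>{0..1}. ccomb t x y \<in> C)"

definition fconvex_hull :: "('a \<Rightarrow> 'b::real_vector) set \<Rightarrow> ('a \<Rightarrow> 'b) set" where
  "fconvex_hull X = \<Inter>{C. fconvex C \<and> X \<subseteq> C}"

definition is_face :: "('a \<Rightarrow> 'b::real_vector) set \<Rightarrow> ('a \<Rightarrow> 'b) set \<Rightarrow> bool" where
  "is_face F C \<longleftrightarrow> F \<subseteq> C \<and> fconvex F \<and>
     (\<forall>x\<in>C. \<forall>y\<in>C. \<forall>t\<in>{0<..<1}. ccomb t x y \<in> F \<longrightarrow> x \<in> F \<and> y \<in> F)"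

definition face_gen :: "('a \<Rightarrow> 'b::real_vector) set \<Rightarrow> ('a \<Rightarrow> 'b) set \<Rightarrow> ('a \<Rightarrow> 'b) set" where
  "face_gen C X = \<Inter>{F. is_face F C \<and> X \<subseteq> F}"

definition Sst :: "('m::finite \<times> 'n::finite) functional set" where
  "Sst = fconvex_hull {vstate (tens x y) | (x :: complex^'m) (y :: complex^'n).
                         unit_vec x \<and> unit_vec y}"

definition csum_expr :: "nat set \<Rightarrow> (nat \<Rightarrow> real) \<Rightarrow> (nat \<Rightarrow> 'a \<Rightarrow> 'b::real_vector) \<Rightarrow> 'a \<Rightarrow> 'b" where
  "csum_expr I lam w = (\<lambda>a. \<Sum>i\<in>I. lam i *\<^sub>R w i a)"

definition is_rep :: "nat \<Rightarrow> (nat \<Rightarrow> ('a \<Rightarrow> 'b::real_vector) set) \<Rightarrow> ('a \<Rightarrow> 'b)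
     \<Rightarrow> nat set \<Rightarrow> (nat \<Rightarrow> real) \<Rightarrow> (nat \<Rightarrow> 'a \<Rightarrow> 'b) \<Rightarrow> bool" where
  "is_rep q Cs x I lam w \<longleftrightarrow> I \<subseteq> {1..q} \<and> (\<forall>i\<in>I. lam i > 0 \<and> w i \<in> Cs i)
     \<and> (\<Sum>i\<in>I. lam i) = 1 \<and> x = csum_expr I lam w"

definition direct_convex_sum :: "('a \<Rightarrow> 'b::real_vector) set \<Rightarrow> nat \<Rightarrow> (nat \<Rightarrow> ('a \<Rightarrow> 'b) set) \<Rightarrow> bool" where
  "direct_convex_sum C q Cs \<longleftrightarrow>
     (\<forall>i\<in>{1..q}. Cs i \<subseteq> C \<and> fconvex (Cs i)) \<and>
     (\<forall>x\<in>C. (\<exists>I lam w. is_rep q Cs x I lam w) \<and>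
        (\<forall>I lam w I' lam' w'. is_rep q Cs x I lam w \<and> is_rep q Cs x I' lam' w' \<longrightarrow>
            I = I' \<and> (\<forall>i\<in>I. lam i = lam' i \<and> w i = w' i)))"

definition is_simplex :: "('a \<Rightarrow> 'b::real_vector) set \<Rightarrow> bool" where
  "is_simplex C \<longleftrightarrow> (\<exists>r pts. direct_convex_sum C r (\<lambda>i. {pts i}))"

definition aff_iso :: "('a \<Rightarrow> 'b::real_vector) set \<Rightarrow> ('c \<Rightarrow> 'd::real_vector) set \<Rightarrow> bool" where
  "aff_iso A B \<longleftrightarrow> (\<exists>\<phi>. bij_betw \<phi> A B \<and>
     (\<forall>x\<in>A. \<forall>y\<in>A. \<forall>t\<in>{0..1}. \<phi> (ccomb t x y) = ccomb t (\<phi> x) (\<phi> y)))"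

end

theory Submission
  imports Defs
begin

text \<open>
  Every state of \<open>B(C^k)\<close> is a finite mixture of vector states (a Cholesky decomposition of its
  density matrix). For a set \<open>Z\<close> of vectors closed under scaling, let \<open>mixtures Z\<close> be the mixtures of
  vector states of unit vectors in \<open>Z\<close>; thus \<open>K\<close> is \<open>mixtures UNIV\<close> and \<open>S\<close> is \<open>mixtures P\<close> with \<open>P\<close> the
  set of product vectors. Testing against rank one projections orthogonal to a subspace \<open>M\<close> shows
  that \<open>mixtures (Y \<inter> M)\<close> is a face of \<open>mixtures Y\<close>. With \<open>Y = P\<close> and \<open>M\<close> the sum of the spaces \<open>L i\<close>,
  independence of the \<open>f j\<close> gives \<open>P \<inter> M = (\<Union>i. L i)\<close>, so the face \<open>F\<close> consists of the mixtures of
  vectors from the \<open>L i\<close>. It decomposes uniquely because the \<open>L i\<close> are linearly independent, hence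
  separated by (non-orthogonal) projections.
\<close>

text \<open>The vectors of a mixture are not unique, but its value at \<open>ketbra w w\<close> is a
  sum of squared moduli, which vanishes only if every vector is orthogonal to \<open>w\<close>. So
  lying in a subspace is a property of the functional, whatever vectors represent it. The obstacle
  is minimality: a face of S containing the generators of block i must contain every mixture from
  \<open>L i\<close>. The average of the generators splits properly into any given vector state from
  \<open>L i\<close> and a remainder, but the remainder is a priori only a state in K, while a face
  of S controls only splittings inside S. It does lie in S, because \<open>L i\<close> is a linear
  space of product vectors and \<open>mixtures (L i)\<close> is therefore a face of K too. The union
  of the \<open>L i\<close> is in general not linear, so minimality of F is obtained block by block.
  The \<open>f j\<close> need not be orthogonal; the separating operators are
  \<open>1 \<otimes> R i\<close>, where \<open>R i\<close> fixes the \<open>f j\<close> of block i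
  and kills the others.\<close>

section \<open>The complex inner product and the operators on C^k\<close>

lemma cinner_add_left: "cinner (x + y) z = cinner x z + cinner y z"
  by (simp add: cinner_def algebra_simps sum.distrib)

lemma cinner_diff_left: "cinner (x - y) z = cinner x z - cinner y z"
  by (simp add: cinner_def algebra_simps sum_subtractf)

lemma cinner_scale_left: "cinner (c *s x) z = c * cinner x z"
  by (simp add: cinner_def algebra_simps sum_distrib_left)

lemma cinner_commute: "cinner y x = cnj (cinner x y)"
  by (simp add: cinner_def mult.commute)

lemma cinner_add_right: "cinner z (x + y) = cinner z x + cinner z y"
  by (simp add: cinner_def algebra_simps sum.distrib)

lemma cinner_diff_right: "cinner z (x - y) = cinner z x - cinner z y"
  by (simp add: cinner_def algebra_simps sum_subtractf)

lemma cinner_scale_right: "cinner z (c *s x) = cnj c * cinner z x"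
  by (simp add: cinner_def algebra_simps sum_distrib_left)

lemma cinner_zero [simp]: "cinner 0 x = 0" "cinner x 0 = 0"
  by (simp_all add: cinner_def)

lemma cinner_sum_left: "cinner (\<Sum>i\<in>I. g i) z = (\<Sum>i\<in>I. cinner (g i) z)"
  by (induction I rule: infinite_finite_induct) (simp_all add: cinner_add_left)

lemma Re_cinner: "Re (cinner x y) = x \<bullet> y"
  by (simp add: cinner_def inner_vec_def inner_complex_def)

lemma cinner_self: "cinner x x = complex_of_real ((norm x)\<^sup>2)"
proof (rule complex_eqI)
  show "Re (cinner x x) = Re (complex_of_real ((norm x)\<^sup>2))"
    by (simp add: Re_cinner power2_norm_eq_inner)
  show "Im (cinner x x) = Im (complex_of_real ((norm x)\<^sup>2))"
    by (simp add: cinner_def)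
qed

lemma unit_vec_iff: "unit_vec x \<longleftrightarrow> norm x = 1"
proof -
  have "unit_vec x \<longleftrightarrow> (norm x)\<^sup>2 = 1"
    unfolding unit_vec_def cinner_self by (metis of_real_1 of_real_eq_iff)
  then show ?thesis
    by (simp add: power2_eq_1_iff) (smt (verit) norm_ge_zero)
qed

lemma norm_vector_scalar_mult: "norm (c *s (x :: complex^'k)) = norm c * norm x"
proof -
  have "complex_of_real ((norm (c *s x))\<^sup>2) = complex_of_real ((norm c * norm x)\<^sup>2)"
    unfolding cinner_self[symmetric] cinner_scale_left cinner_scale_right
    by (simp add: cinner_self power_mult_distrib complex_norm_square[unfolded of_real_power] mult_ac)
  then have "(norm (c *s x))\<^sup>2 = (norm c * norm x)\<^sup>2"
    by (simp only: of_real_eq_iff)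
  then show ?thesis
    by (simp add: power2_eq_iff_nonneg)
qed

lemma bops_UNIV_iff: "A \<in> bops UNIV \<longleftrightarrow> Vector_Spaces.linear (*s) (*s) A"
  by (auto simp: bops_def Vector_Spaces.linear_iff vec.vector_space_axioms)

lemma bops_UNIV_simps:
  assumes "A \<in> bops UNIV"
  shows "A (x + y) = A x + A y" "A (c *s x) = c *s A x" "A 0 = 0" "A (x - y) = A x - A y"
    and "A (\<Sum>i\<in>I. g i) = (\<Sum>i\<in>I. A (g i))"
proof -
  interpret A: Vector_Spaces.linear "(*s)" "(*s)" A
    using assms by (simp add: bops_UNIV_iff)
  show "A (x + y) = A x + A y" "A (c *s x) = c *s A x" "A 0 = 0" "A (x - y) = A x - A y"
    "A (\<Sum>i\<in>I. g i) = (\<Sum>i\<in>I. A (g i))"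
    by (simp_all add: A.add A.scale A.zero A.diff A.sum)
qed

lemma bops_UNIV_add:
  "A \<in> bops UNIV \<Longrightarrow> B \<in> bops UNIV \<Longrightarrow> (\<lambda>x. A x + B x) \<in> bops UNIV"
  by (simp add: bops_def vec.scale_right_distrib)

lemma bops_UNIV_scale:
  "A \<in> bops UNIV \<Longrightarrow> (\<lambda>x. c *s A x) \<in> bops UNIV"
  by (simp add: bops_def vec.scale_right_distrib mult.commute)

lemma bops_UNIV_compose:
  "A \<in> bops UNIV \<Longrightarrow> B \<in> bops UNIV \<Longrightarrow> (\<lambda>x. A (B x)) \<in> bops UNIV"
  by (simp add: bops_def)

lemma bops_UNIV_id: "(\<lambda>x. x) \<in> bops UNIV"
  by (simp add: bops_def)

lemma idop_UNIV: "idop UNIV = (\<lambda>x. x)"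
  by (simp add: idop_def)

section \<open>Positive sesquilinear forms\<close>

definition psd_form :: "(complex^'k \<Rightarrow> complex^'k \<Rightarrow> complex) \<Rightarrow> bool" where
  "psd_form B \<longleftrightarrow> (\<forall>x y z. B (x + y) z = B x z + B y z) \<and> (\<forall>c x z. B (c *s x) z = c * B x z)
     \<and> (\<forall>x y z. B z (x + y) = B z x + B z y) \<and> (\<forall>c x z. B z (c *s x) = cnj c * B z x)
     \<and> (\<forall>x. Im (B x x) = 0 \<and> Re (B x x) \<ge> 0)"

lemma psd_formD:
  assumes "psd_form B"
  shows "B (x + y) z = B x z + B y z" "B (c *s x) z = c * B x z"
    "B z (x + y) = B z x + B z y" "B z (c *s x) = cnj c * B z x"
    "Im (B x x) = 0" "Re (B x x) \<ge> 0"
  using assms unfolding psd_form_def by blast+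

lemma psd_form_zero:
  assumes "psd_form B"
  shows "B 0 z = 0" "B z 0 = 0"
  using psd_formD(2)[OF assms, of 0 0 z] psd_formD(4)[OF assms, of z 0 0] by simp_all

lemma psd_form_sum_left:
  assumes "psd_form B"
  shows "B (\<Sum>i\<in>I. g i) z = (\<Sum>i\<in>I. B (g i) z)"
  by (induction I rule: infinite_finite_induct)
    (simp_all add: psd_form_zero[OF assms] psd_formD(1)[OF assms])

text \<open>Polarisation: the form is real at \<open>x + y\<close>, which settles the imaginary
  parts, and at \<open>x + \<i> *s y\<close>, which settles the real parts.\<close>

lemma psd_form_hermitian:
  assumes "psd_form B"
  shows "B y x = cnj (B x y)"
proof -
  note D = psd_formD[OF assms]
  have 1: "B (x + y) (x + y) = B x x + B x y + B y x + B y y"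
    by (simp add: D(1,3))
  have 2: "B (x + \<i> *s y) (x + \<i> *s y) = B x x - \<i> * B x y + \<i> * B y x + B y y"
    by (simp add: D(1-4) algebra_simps)
  have "Im (B x y) + Im (B y x) = 0"
    using D(5)[of "x + y"] D(5)[of x] D(5)[of y] unfolding 1 by simp
  moreover have "Re (B y x) - Re (B x y) = 0"
    using D(5)[of "x + \<i> *s y"] D(5)[of x] D(5)[of y] unfolding 2 by simp
  ultimately show ?thesis
    by (intro complex_eqI) simp_all
qed

lemma psd_form_self_zero:
  assumes "psd_form B" and "B s s = 0"
  shows "B s x = 0"
proof (rule ccontr)
  note D = psd_formD[OF assms(1)]
  assume nz: "B s x \<noteq> 0"
  define r where "r = (norm (B s x))\<^sup>2"
  have r: "r > 0" "B s x * cnj (B s x) = of_real r"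
    using nz by (simp_all add: r_def complex_norm_square[unfolded of_real_power])
  \<comment> \<open>With this \<open>t\<close> the form takes a value with real part -1 at
    \<open>x + c *s s\<close>, contradicting positivity.\<close>
  define t where "t = (Re (B x x) + 1) / (2 * r)"
  define c where "c = - (of_real t * cnj (B s x))"
  have "B (x + c *s s) (x + c *s s) = B x x + c * B s x + cnj c * B x s"
    by (simp add: D(1-4) assms(2) algebra_simps)
  also have "B x s = cnj (B s x)"
    by (rule psd_form_hermitian[OF assms(1)])
  also have "B x x + c * B s x + cnj c * cnj (B s x) = B x x - of_real (2 * t * r)"
    using r(2) unfolding c_def by (simp add: algebra_simps)
  finally have "Re (B x x) - 2 * t * r \<ge> 0"
    using D(6)[of "x + c *s s"] by simp
  moreover have "2 * t * r = Re (B x x) + 1"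
    using r(1) by (simp add: t_def)
  ultimately show False by simp
qed

text \<open>This is the Schur complement at the pivot \<open>s\<close>. Its diagonal value at
  \<open>x\<close> is the value of \<open>B\<close> at \<open>x\<close> shifted by the multiple of
  \<open>s\<close> that makes it \<open>B\<close>-orthogonal to \<open>s\<close>, hence
  nonnegative.\<close>

lemma psd_form_deflate:
  assumes B: "psd_form B" and nz: "B s s \<noteq> 0"
  shows "psd_form (\<lambda>x y. B x y - B x s * B s y / B s s)"
proof -
  note D = psd_formD[OF B]
  have herm: "B s y = cnj (B y s)" for y
    by (rule psd_form_hermitian[OF B])
  have sq: "B x x - B x s * B s x / B s s = B (x + c *s s) (x + c *s s)"
    if c: "c = - (B x s / B s s)" for x c
  proof -
    have "cnj (B s s) = B s s"
      using herm[of s] by simp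
    then have cc: "cnj c = - (B s x / B s s)"
      by (simp add: c herm[of x])
    have "B (x + c *s s) (x + c *s s) = B x x + c * B s x + cnj c * B x s + c * cnj c * B s s"
      by (simp add: D(1-4) algebra_simps)
    also have "\<dots> = B x x - B x s * B s x / B s s"
      unfolding cc c using nz by (simp add: field_simps)
    finally show ?thesis by simp
  qed
  have pos: "Im (B x x - B x s * B s x / B s s) = 0 \<and> Re (B x x - B x s * B s x / B s s) \<ge> 0" for x
    unfolding sq[OF refl] using D(5,6) by blast
  show ?thesis
    unfolding psd_form_def
  proof (intro conjI allI)
    show "Im (B x x - B x s * B s x / B s s) = 0" "0 \<le> Re (B x x - B x s * B s x / B s s)" for x
      using pos by blast+
  qed (simp_all add: D(1-4) distrib_right distrib_left add_divide_distrib right_diff_distrib mult.assoc mult.left_commute)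
qed

text \<open>Cholesky elimination: \<open>T\<close> holds the coordinates not yet eliminated, and the
  basis vectors outside \<open>T\<close> lie in the kernel of the form. Subtracting the rank one
  form of a nonzero pivot moves its basis vector into the kernel.\<close>

lemma psd_form_decomposition_aux:
  fixes B :: "complex^'k \<Rightarrow> complex^'k \<Rightarrow> complex"
  assumes "finite T" and "psd_form B" and "\<And>i y. i \<notin> T \<Longrightarrow> B (axis i 1) y = 0"
  shows "\<exists>v. \<forall>x y. B x y = (\<Sum>k\<in>T. cinner x (v k) * cnj (cinner y (v k)))"
  using assms
proof (induction T arbitrary: B rule: finite_induct)
  case empty
  have "B x y = 0" for x y
  proof -
    have "B x y = B (\<Sum>i\<in>UNIV. x $ i *s axis i 1) y"
      by (simp add: basis_expansion)
    also have "\<dots> = 0"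
      using empty.prems(2)
      by (simp add: psd_form_sum_left[OF empty.prems(1)] psd_formD(2)[OF empty.prems(1)])
    finally show ?thesis .
  qed
  then show ?case by simp
next
  case (insert s T)
  note B = insert.prems(1)
  define a :: "complex^'k" where "a = axis s 1"
  show ?case
  proof (cases "B a a = 0")
    case True
    \<comment> \<open>A zero pivot forces its basis vector into the kernel, so the vector 0 can be
      used at this index.\<close>
    then have "B (axis i 1) y = 0" if "i \<notin> T" for i y
      using insert.prems(2)[of i y] psd_form_self_zero[OF B, of a y] that
      by (cases "i = s") (auto simp: a_def)
    from insert.IH[OF B this] obtain v
      where v: "\<And>x y. B x y = (\<Sum>k\<in>T. cinner x (v k) * cnj (cinner y (v k)))"
      by blast
    have "(\<Sum>k\<in>T. cinner x ((v(s := 0)) k) * cnj (cinner y ((v(s := 0)) k))) =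
          (\<Sum>k\<in>T. cinner x (v k) * cnj (cinner y (v k)))" for x y
      using insert.hyps by (intro sum.cong) auto
    then show ?thesis
      using insert.hyps v by (intro exI[of _ "v(s := 0)"]) simp
  next
    case False
    define B' where "B' = (\<lambda>x y. B x y - B x a * B a y / B a a)"
    have B': "psd_form B'"
      unfolding B'_def by (rule psd_form_deflate[OF B False])
    have "B' (axis i 1) y = 0" if "i \<notin> T" for i y
      using insert.prems(2)[of i] that False
      by (cases "i = s") (auto simp: a_def B'_def)
    from insert.IH[OF B' this] obtain v
      where v: "\<And>x y. B' x y = (\<Sum>k\<in>T. cinner x (v k) * cnj (cinner y (v k)))"
      by blast
    define r where "r = Re (B a a)"
    have Baa: "B a a = of_real r"
      using psd_formD(5)[OF B, of a] by (simp add: r_def complex_eq_iff)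
    then have r: "r > 0"
      using False psd_formD(6)[OF B, of a] by (cases "r = 0") (auto simp: r_def)
    \<comment> \<open>The coordinates represent the linear functional \<open>B x a / sqrt r\<close>
      of \<open>x\<close>; they are conjugated because \<open>cinner\<close> is conjugate linear in
      its second argument.\<close>
    define u :: "complex^'k" where "u = (\<chi> i. cnj (B (axis i 1) a / of_real (sqrt r)))"
    have u: "cinner x u = B x a / of_real (sqrt r)" for x
    proof -
      have "B x a = B (\<Sum>i\<in>UNIV. x $ i *s axis i 1) a"
        by (simp add: basis_expansion)
      also have "\<dots> = (\<Sum>i\<in>UNIV. x $ i * B (axis i 1) a)"
        by (simp add: psd_form_sum_left[OF B] psd_formD(2)[OF B])
      finally show ?thesis
        by (simp add: cinner_def u_def sum_divide_distrib)
    qed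
    have "B x a * B a y / B a a = cinner x u * cnj (cinner y u)" for x y
    proof -
      have "B a y = cnj (B y a)"
        by (rule psd_form_hermitian[OF B])
      moreover have "complex_of_real r = of_real (sqrt r) * of_real (sqrt r)"
        using r by (simp flip: of_real_mult)
      ultimately show ?thesis
        unfolding u Baa by simp
    qed
    then have BB': "B x y = B' x y + cinner x u * cnj (cinner y u)" for x y
      by (simp add: B'_def)
    have "(\<Sum>k\<in>T. cinner x ((v(s := u)) k) * cnj (cinner y ((v(s := u)) k))) =
          (\<Sum>k\<in>T. cinner x (v k) * cnj (cinner y (v k)))" for x y
      using insert.hyps by (intro sum.cong) auto
    then show ?thesis
      using insert.hyps v by (intro exI[of _ "v(s := u)"]) (simp add: BB' add.commute)
  qed
qed

lemma psd_form_decomposition: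
  fixes B :: "complex^'k \<Rightarrow> complex^'k \<Rightarrow> complex"
  assumes "psd_form B"
  obtains v :: "'k \<Rightarrow> complex^'k"
    where "\<And>x y. B x y = (\<Sum>k\<in>UNIV. cinner x (v k) * cnj (cinner y (v k)))"
  using psd_form_decomposition_aux[OF finite_class.finite_UNIV assms] by auto


section \<open>Mixtures of vector states\<close>

definition ketbra :: "complex^'k \<Rightarrow> complex^'k \<Rightarrow> complex^'k \<Rightarrow> complex^'k" where
  "ketbra x y = (\<lambda>z. cinner z y *s x)"

lemma ketbra_bops: "ketbra x y \<in> bops UNIV"
  by (simp add: ketbra_def bops_def cinner_add_left cinner_scale_left vec.scale_left_distrib)

lemma cinner_ketbra_self: "cinner (ketbra w w z) z = of_real ((norm (cinner z w))\<^sup>2)"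
  unfolding ketbra_def cinner_scale_left complex_norm_square
  by (simp add: cinner_commute[of w z])

lemma pos_op_ketbra: "pos_op M (ketbra w w)"
  by (simp add: pos_op_def cinner_ketbra_self)

text \<open>This is A |-> tr(rho A) with rho the sum of the rank one operators
  \<open>ketbra (z k) (z k)\<close>.\<close>

definition mix :: "'i set \<Rightarrow> ('i \<Rightarrow> complex^'k) \<Rightarrow> 'k functional" where
  "mix N z = (\<lambda>A. if A \<in> bops UNIV then \<Sum>k\<in>N. cinner (A (z k)) (z k) else 0)"

text \<open>The vectors \<open>z k\<close> are not normalised: the squared norms are the weights of the mixture.\<close>

definition mixtures :: "(complex^'k) set \<Rightarrow> 'k functional set" where
  "mixtures Z = {mix N z | (N :: nat set) z. finite N \<and> z ` N \<subseteq> Z \<and> (\<Sum>k\<in>N. (norm (z k))\<^sup>2) = 1}"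

definition scale_closed :: "(complex^'k) set \<Rightarrow> bool" where
  "scale_closed Z \<longleftrightarrow> (\<forall>c. \<forall>z\<in>Z. c *s z \<in> Z)"

text \<open>A set cannot quantify over index types, so \<open>mixtures\<close> fixes natural
  numbers. Transport along an enumeration admits any finite index set, such as a disjoint sum for
  convexity or the coordinates in \<open>states_UNIV\<close>.\<close>

lemma mixturesI:
  fixes N :: "'i set"
  assumes "finite N" and "z ` N \<subseteq> Z" and "(\<Sum>k\<in>N. (norm (z k))\<^sup>2) = 1"
  shows "mix N z \<in> mixtures Z"
proof -
  obtain h where h: "bij_betw h {0..<card N} N"
    using ex_bij_betw_nat_finite[OF assms(1)] by blast
  have "mix N z = mix {0..<card N} (z \<circ> h)"
    using sum.reindex_bij_betw[OF h, of "\<lambda>k. cinner (_ (z k)) (z k)"]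
    by (auto simp: mix_def fun_eq_iff)
  moreover have "(\<Sum>k\<in>{0..<card N}. (norm ((z \<circ> h) k))\<^sup>2) = 1"
    using sum.reindex_bij_betw[OF h, of "\<lambda>k. (norm (z k))\<^sup>2"] assms(3) by simp
  moreover have "(z \<circ> h) ` {0..<card N} \<subseteq> Z"
    using h assms(2) by (auto simp: bij_betw_def)
  ultimately show ?thesis
    unfolding mixtures_def by blast
qed

lemma mixturesE:
  assumes "x \<in> mixtures Z"
  obtains N :: "nat set" and z where "finite N" "\<forall>k\<in>N. z k \<in> Z"
    "(\<Sum>k\<in>N. (norm (z k))\<^sup>2) = 1" "x = mix N z"
  using assms unfolding mixtures_def by blast

lemma mixtures_mono: "Z \<subseteq> Y \<Longrightarrow> mixtures Z \<subseteq> mixtures Y"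
  unfolding mixtures_def by blast

lemma mixtures_remove_zero: "mixtures (Z - {0}) = mixtures Z"
proof
  show "mixtures Z \<subseteq> mixtures (Z - {0})"
  proof
    fix x assume "x \<in> mixtures Z"
    then obtain N :: "nat set" and z where N: "finite N" "\<forall>k\<in>N. z k \<in> Z"
      "(\<Sum>k\<in>N. (norm (z k))\<^sup>2) = 1" "x = mix N z"
      by (rule mixturesE)
    define N' where "N' = {k \<in> N. z k \<noteq> 0}"
    have "(\<Sum>k\<in>N'. cinner (A (z k)) (z k)) = (\<Sum>k\<in>N. cinner (A (z k)) (z k))" for A
      using N(1) by (intro sum.mono_neutral_left) (auto simp: N'_def)
    then have "mix N z = mix N' z"
      by (auto simp: mix_def fun_eq_iff)
    moreover have "(\<Sum>k\<in>N'. (norm (z k))\<^sup>2) = (\<Sum>k\<in>N. (norm (z k))\<^sup>2)"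
      using N(1) by (intro sum.mono_neutral_left) (auto simp: N'_def)
    ultimately show "x \<in> mixtures (Z - {0})"
      using N by (auto simp: N'_def intro!: mixturesI)
  qed
qed (auto intro!: mixtures_mono)

lemma vstate_in_mixtures:
  assumes "z \<in> Z" "norm z = 1"
  shows "vstate z \<in> mixtures Z"
proof -
  have "vstate z = mix {()} (\<lambda>_. z)"
    by (auto simp: vstate_def mix_def)
  then show ?thesis
    using assms by (auto intro!: mixturesI)
qed

lemma fconvex_mixtures:
  assumes "scale_closed Z"
  shows "fconvex (mixtures Z)"
  unfolding fconvex_def
proof (intro ballI)
  fix x y :: "'a functional" and t :: real
  assume "x \<in> mixtures Z" "y \<in> mixtures Z" and t: "t \<in> {0..1}"
  obtain N :: "nat set" and z where N: "finite N" "\<forall>k\<in>N. z k \<in> Z"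
      "(\<Sum>k\<in>N. (norm (z k))\<^sup>2) = 1" "x = mix N z"
    using \<open>x \<in> mixtures Z\<close> by (rule mixturesE)
  obtain M :: "nat set" and w where M: "finite M" "\<forall>k\<in>M. w k \<in> Z"
      "(\<Sum>k\<in>M. (norm (w k))\<^sup>2) = 1" "y = mix M w"
    using \<open>y \<in> mixtures Z\<close> by (rule mixturesE)
  \<comment> \<open>The weights \<open>t\<close> and \<open>1 - t\<close> are absorbed into the
    vectors as square roots.\<close>
  define v where "v = case_sum (\<lambda>k. of_real (sqrt t) *s z k) (\<lambda>k. of_real (sqrt (1 - t)) *s w k)"
  have sq: "complex_of_real (sqrt s) * (complex_of_real (sqrt s) * a) = s *\<^sub>R a"
    if "s \<ge> 0" for s a
    using that by (simp add: scaleR_conv_of_real flip: mult.assoc of_real_mult)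
  have "ccomb t x y = mix (N <+> M) v"
    using t N(1) M(1)
    by (auto simp: fun_eq_iff ccomb_def mix_def N(4) M(4) v_def sum.Plus bops_UNIV_simps
        cinner_scale_left cinner_scale_right sq scaleR_sum_right)
  moreover have "(\<Sum>k\<in>N <+> M. (norm (v k))\<^sup>2) = 1"
    using t N(1,3) M(1,3)
    by (simp add: sum.Plus v_def norm_vector_scalar_mult power_mult_distrib flip: sum_distrib_left)
  moreover have "v ` (N <+> M) \<subseteq> Z"
    using assms N(2) M(2) by (auto simp: v_def scale_closed_def)
  ultimately show "ccomb t x y \<in> mixtures Z"
    using N(1) M(1) by (auto intro!: mixturesI)
qed

lemma fconvex_sum:
  assumes "finite I" and "fconvex C" and "\<And>i. i \<in> I \<Longrightarrow> w i \<in> C"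
    and "\<And>i. i \<in> I \<Longrightarrow> lam i \<ge> 0" and "(\<Sum>i\<in>I. lam i) = 1"
  shows "(\<lambda>a. \<Sum>i\<in>I. lam i *\<^sub>R w i a) \<in> C"
  using assms(1,3-5)
proof (induction I arbitrary: lam rule: finite_induct)
  case empty
  then show ?case by simp
next
  case (insert j I)
  define s where "s = (\<Sum>i\<in>I. lam i)"
  have s: "lam j = 1 - s" "s \<ge> 0"
    using insert.prems insert.hyps by (auto simp: s_def intro!: sum_nonneg)
  moreover have "lam j \<ge> 0"
    using insert.prems by simp
  ultimately have s1: "s \<le> 1" by simp
  show ?case
  \<comment> \<open>Remaining weights of sum 0 cannot be renormalised; the combination is then just
    \<open>w j\<close>.\<close>
  proof (cases "s = 0")
    case True
    then have "\<forall>i\<in>I. lam i = 0"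
      using insert.prems insert.hyps by (simp add: s_def sum_nonneg_eq_0_iff)
    then have "(\<lambda>a. \<Sum>i\<in>insert j I. lam i *\<^sub>R w i a) = w j"
      using insert.hyps s True by (auto simp: fun_eq_iff)
    then show ?thesis
      using insert.prems by simp
  next
    case False
    have "(\<lambda>a. \<Sum>i\<in>I. (lam i / s) *\<^sub>R w i a) \<in> C"
    proof (rule insert.IH)
      show "(\<Sum>i\<in>I. lam i / s) = 1"
        using False by (simp add: s_def flip: sum_divide_distrib)
    qed (use insert.prems s in auto)
    then have "ccomb s (\<lambda>a. \<Sum>i\<in>I. (lam i / s) *\<^sub>R w i a) (w j) \<in> C"
      using assms(2) s s1 insert.prems by (simp add: fconvex_def)
    also have "ccomb s (\<lambda>a. \<Sum>i\<in>I. (lam i / s) *\<^sub>R w i a) (w j) =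
        (\<lambda>a. \<Sum>i\<in>insert j I. lam i *\<^sub>R w i a)"
      using insert.hyps s False by (simp add: ccomb_def fun_eq_iff scaleR_sum_right)
    finally show ?thesis .
  qed
qed

text \<open>Normalising the nonzero \<open>z k\<close> turns a mixture into a convex combination of
  vector states with weights \<open>(norm (z k))\<^sup>2\<close>. Inclusion in a convex set, in
  particular in a face, thus reduces to vector states.\<close>

lemma mixtures_subset_fconvex:
  assumes "fconvex C" and "scale_closed Z" and "\<And>z. z \<in> Z \<Longrightarrow> norm z = 1 \<Longrightarrow> vstate z \<in> C"
  shows "mixtures Z \<subseteq> C"
proof
  fix x assume "x \<in> mixtures Z"
  then have "x \<in> mixtures (Z - {0})"
    by (simp add: mixtures_remove_zero)
  then obtain N :: "nat set" and z where N: "finite N" "\<forall>k\<in>N. z k \<in> Z - {0}"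
      "(\<Sum>k\<in>N. (norm (z k))\<^sup>2) = 1" "x = mix N z"
    by (rule mixturesE)
  define v where "v k = of_real (1 / norm (z k)) *s z k" for k
  have v: "v k \<in> Z" "norm (v k) = 1" if "k \<in> N" for k
    using bspec[OF N(2) that] assms(2) by (auto simp: v_def scale_closed_def norm_vector_scalar_mult norm_divide)
  have "(\<lambda>A. \<Sum>k\<in>N. (norm (z k))\<^sup>2 *\<^sub>R vstate (v k) A) \<in> C"
    using v assms(3) N by (intro fconvex_sum[OF _ assms(1)]) auto
  also have "(\<lambda>A. \<Sum>k\<in>N. (norm (z k))\<^sup>2 *\<^sub>R vstate (v k) A) = x"
  proof
    fix A
    have "(norm (z k))\<^sup>2 *\<^sub>R cinner (A (v k)) (v k) = cinner (A (z k)) (z k)"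
      if "k \<in> N" "A \<in> bops UNIV" for k
      using bspec[OF N(2) that(1)] that(2)
      by (simp add: v_def bops_UNIV_simps cinner_scale_left cinner_scale_right scaleR_conv_of_real
          power2_eq_square field_simps)
    then show "(\<Sum>k\<in>N. (norm (z k))\<^sup>2 *\<^sub>R vstate (v k) A) = x A"
      by (auto simp: N(4) mix_def vstate_def)
  qed
  finally show "x \<in> C" .
qed

section \<open>Every state of B(C^k) is a mixture\<close>

lemma states_sum:
  assumes w: "w \<in> states UNIV" and A: "\<And>i. i \<in> I \<Longrightarrow> A i \<in> bops UNIV" and "finite I"
  shows "w (\<lambda>x. \<Sum>i\<in>I. A i x) = (\<Sum>i\<in>I. w (A i)) \<and> (\<lambda>x. \<Sum>i\<in>I. A i x) \<in> bops UNIV"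
  using assms(3) A
proof (induction I rule: finite_induct)
  case empty
  have "w (\<lambda>x. 0 *s x) = 0 * w (\<lambda>x. x)"
    using w bops_UNIV_id unfolding states_def by fast
  then show ?case
    by (simp add: bops_def)
next
  case (insert i I)
  have add: "\<forall>A\<in>bops UNIV. \<forall>B\<in>bops UNIV. w (\<lambda>x. A x + B x) = w A + w B"
    using w unfolding states_def by blast
  have Ai: "A i \<in> bops UNIV" and AI: "(\<lambda>x. \<Sum>i\<in>I. A i x) \<in> bops UNIV"
    and IH: "w (\<lambda>x. \<Sum>i\<in>I. A i x) = (\<Sum>i\<in>I. w (A i))"
    using insert by simp_all
  show ?case
    using add[rule_format, OF Ai AI] bops_UNIV_add[OF Ai AI] IH insert.hyps by simp
qed

lemma mixtures_UNIV_subset_states: "mixtures UNIV \<subseteq> states UNIV"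
proof
  fix x :: "'a functional" assume "x \<in> mixtures UNIV"
  then obtain N :: "nat set" and z where N: "(\<Sum>k\<in>N. (norm (z k))\<^sup>2) = 1" "x = mix N z"
    by (rule mixturesE)
  have "x (idop UNIV) = 1"
    using N(1) bops_UNIV_id unfolding N(2) idop_UNIV
    by (simp add: mix_def cinner_self flip: of_real_power of_real_sum)
  then show "x \<in> states UNIV"
    unfolding states_def
    by (auto simp: N(2) mix_def bops_UNIV_add bops_UNIV_scale cinner_add_left cinner_scale_left
        sum.distrib sum_distrib_left pos_op_def intro!: sum_nonneg)
qed

text \<open>A state is determined by its values on rank one operators. These values form a positive
  sesquilinear form, and the vectors of its decomposition represent the state; their normalisation
  is the value 1 at the identity.\<close>

lemma states_UNIV: "states UNIV = mixtures (UNIV :: (complex^'k) set)"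
proof
  show "states UNIV \<subseteq> mixtures (UNIV :: (complex^'k) set)"
  proof
    fix w :: "'k functional" assume w: "w \<in> states UNIV"
    have add: "w (\<lambda>x. A x + B x) = w A + w B" if "A \<in> bops UNIV" "B \<in> bops UNIV" for A B
      using w that unfolding states_def by blast
    have scale: "w (\<lambda>x. c *s A x) = c * w A" if "A \<in> bops UNIV" for A c
      using w that unfolding states_def by blast
    have pos: "Im (w A) = 0 \<and> Re (w A) \<ge> 0" if "A \<in> bops UNIV" "pos_op UNIV A" for A
      using w that unfolding states_def by blast
    define B where "B = (\<lambda>x y. w (ketbra x y))"
    have "psd_form B"
      unfolding psd_form_def
    proof (intro conjI allI)
      fix x y z :: "complex^'k" and c :: complex
      show "B (x + y) z = B x z + B y z"
        unfolding B_def by (simp flip: add[OF ketbra_bops ketbra_bops])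
          (simp add: ketbra_def vec.scale_right_distrib)
      show "B z (x + y) = B z x + B z y"
        unfolding B_def by (simp flip: add[OF ketbra_bops ketbra_bops])
          (simp add: ketbra_def vec.scale_left_distrib cinner_add_right)
      show "B (c *s x) z = c * B x z"
        unfolding B_def by (simp flip: scale[OF ketbra_bops])
          (simp add: ketbra_def mult.commute)
      show "B z (c *s x) = cnj c * B z x"
        unfolding B_def by (simp flip: scale[OF ketbra_bops])
          (simp add: ketbra_def cinner_scale_right)
      show "Im (B x x) = 0" "Re (B x x) \<ge> 0"
        using pos[OF ketbra_bops pos_op_ketbra] by (simp_all add: B_def)
    qed
    then obtain v :: "'k \<Rightarrow> complex^'k"
      where v: "\<And>x y. B x y = (\<Sum>k\<in>UNIV. cinner x (v k) * cnj (cinner y (v k)))"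
      using psd_form_decomposition by blast
    have wA: "w A = (\<Sum>k\<in>UNIV. cinner (A (v k)) (v k))" if A: "A \<in> bops UNIV" for A
    proof -
      have ax: "cinner x (axis j 1) = x $ j" for x :: "complex^'k" and j
        by (simp add: cinner_def axis_def if_distrib cong: if_cong)
      \<comment> \<open>Column by column, \<open>A\<close> is a sum of rank one operators, so that
        \<open>w A\<close> is a sum of values of \<open>B\<close>.\<close>
      have "A x = (\<Sum>j\<in>UNIV. ketbra (A (axis j 1)) (axis j 1) x)" for x
      proof -
        have "A x = A (\<Sum>j\<in>UNIV. x $ j *s axis j 1)"
          by (simp add: basis_expansion)
        then show ?thesis
          by (simp add: bops_UNIV_simps[OF A] ketbra_def ax)
      qed
      then have "A = (\<lambda>x. \<Sum>j\<in>UNIV. ketbra (A (axis j 1)) (axis j 1) x)"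
        by (rule ext)
      then have "w A = w (\<lambda>x. \<Sum>j\<in>UNIV. ketbra (A (axis j 1)) (axis j 1) x)"
        by (rule arg_cong)
      also have "\<dots> = (\<Sum>j\<in>UNIV. B (A (axis j 1)) (axis j 1))"
        unfolding B_def using states_sum[OF w, of UNIV "\<lambda>j. ketbra (A (axis j 1)) (axis j 1)"]
        by (simp add: ketbra_bops)
      also have "\<dots> = (\<Sum>k\<in>UNIV. \<Sum>j\<in>UNIV. cinner (A (axis j 1)) (v k) * v k $ j)"
        unfolding v cinner_commute[of "v _" "axis _ 1", symmetric] ax by (rule sum.swap)
      also have "\<dots> = (\<Sum>k\<in>UNIV. cinner (A (\<Sum>j\<in>UNIV. v k $ j *s axis j 1)) (v k))"
        by (simp add: bops_UNIV_simps[OF A] cinner_sum_left cinner_scale_left mult.commute)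
      finally show ?thesis
        by (simp add: basis_expansion)
    qed
    have "w = mix UNIV v"
      using w wA by (auto simp: mix_def fun_eq_iff states_def)
    moreover have "(\<Sum>k\<in>UNIV. (norm (v k))\<^sup>2) = 1"
    proof -
      have "w (\<lambda>x. x) = 1"
        using w by (simp add: states_def idop_UNIV)
      then have "complex_of_real (\<Sum>k\<in>UNIV. (norm (v k))\<^sup>2) = 1"
        using wA[OF bops_UNIV_id] by (simp add: cinner_self)
      then show ?thesis
        using of_real_eq_1_iff by blast
    qed
    ultimately show "w \<in> mixtures UNIV"
      by (simp add: mixturesI)
  qed
qed (rule mixtures_UNIV_subset_states)


section \<open>Faces of mixtures\<close>

lemma subspace_scale_closed: "vec.subspace M \<Longrightarrow> scale_closed M"
  by (simp add: scale_closed_def vec.subspace_scale)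

section \<open>Orthogonal projections onto complex subspaces\<close>

lemma csubspace_orthogonal_decomposition:
  fixes M :: "(complex^'k) set"
  assumes M: "vec.subspace M"
  obtains y where "y \<in> M" "\<And>w. w \<in> M \<Longrightarrow> cinner (x - y) w = 0"
proof -
  have sc: "r *\<^sub>R v = of_real r *s v" for r and v :: "complex^'k"
    by (simp add: vec_eq_iff) (simp add: scaleR_conv_of_real)
  have "subspace M"
    using M unfolding subspace_def vec.subspace_def by (simp add: sc)
  then have "span M = M"
    by (simp add: span_eq_iff)
  then obtain y z where yz: "y \<in> M" "\<And>w. w \<in> M \<Longrightarrow> orthogonal z w" "x = y + z"
    using orthogonal_subspace_decomp_exists[of M x] by metis
  have "cinner (x - y) w = 0" if w: "w \<in> M" for w
  proof (rule complex_eqI)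
    show "Re (cinner (x - y) w) = Re 0"
      using yz(2)[OF w] yz(3) by (simp add: Re_cinner orthogonal_def)
    \<comment> \<open>Real orthogonality yields only the real part; since \<open>M\<close> also
      contains \<open>\<i> *s w\<close>, it yields the imaginary part as well.\<close>
    have "Re (cinner z (\<i> *s w)) = 0"
      using yz(2)[of "\<i> *s w"] M w by (simp add: Re_cinner orthogonal_def vec.subspace_scale)
    then show "Im (cinner (x - y) w) = Im 0"
      using yz(3) by (simp add: cinner_scale_right)
  qed
  with yz(1) show thesis
    by (rule that)
qed

text \<open>The component of \<open>x\<close> orthogonal to \<open>M\<close> is itself a test vector
  \<open>w\<close>, and \<open>cinner x w\<close> is then its squared norm. This form of membership
  is the one that rank one operators can detect.\<close>

lemma in_csubspace_iff:
  assumes M: "vec.subspace M"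
  shows "x \<in> M \<longleftrightarrow> (\<forall>w. (\<forall>v\<in>M. cinner v w = 0) \<longrightarrow> cinner x w = 0)"
proof (intro iffI allI impI)
  assume *: "\<forall>w. (\<forall>v\<in>M. cinner v w = 0) \<longrightarrow> cinner x w = 0"
  obtain y where y: "y \<in> M" "\<And>w. w \<in> M \<Longrightarrow> cinner (x - y) w = 0"
    using csubspace_orthogonal_decomposition[OF M] by blast
  have perp: "\<forall>v\<in>M. cinner v (x - y) = 0"
    using y(2) by (metis cinner_commute complex_cnj_zero)
  then have "cinner (x - y) (x - y) = 0"
    using * y(1) by (simp add: cinner_diff_left)
  then have "x = y"
    by (simp add: cinner_self)
  with y(1) show "x \<in> M" by simp
qed blast

lemma csubspace_projection:
  fixes M :: "(complex^'k) set"
  assumes M: "vec.subspace M"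
  obtains P where "P \<in> bops UNIV" "\<And>x. P x \<in> M" "\<And>x. x \<in> M \<Longrightarrow> P x = x"
    "\<And>x w. w \<in> M \<Longrightarrow> cinner (P x) w = cinner x w"
proof -
  have "\<forall>x. \<exists>y. y \<in> M \<and> (\<forall>w\<in>M. cinner (x - y) w = 0)"
    using csubspace_orthogonal_decomposition[OF M] by metis
  then obtain P where P: "\<And>x. P x \<in> M" "\<And>x w. w \<in> M \<Longrightarrow> cinner (x - P x) w = 0"
    by metis
  \<comment> \<open>Uniqueness of the decomposition makes the pointwise choice \<open>P\<close>
    linear and the identity on \<open>M\<close>.\<close>
  have uniq: "P x = y" if "y \<in> M" "\<And>w. w \<in> M \<Longrightarrow> cinner (x - y) w = 0" for x y
  proof -
    have "P x - y \<in> M"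
      using P(1) that(1) M by (simp add: vec.subspace_diff)
    then have "cinner ((x - y) - (x - P x)) (P x - y) = 0"
      using P(2) that(2) cinner_diff_left[of "x - y" "x - P x"] by simp
    then show ?thesis
      by (simp add: cinner_self)
  qed
  show thesis
  proof (rule that)
    show "P \<in> bops UNIV"
      unfolding bops_def
    proof (intro CollectI conjI ballI allI impI)
      fix x y :: "complex^'k" and c
      show "P (x + y) = P x + P y"
      proof (rule uniq)
        show "P x + P y \<in> M"
          using P(1) M by (simp add: vec.subspace_add)
        show "cinner (x + y - (P x + P y)) w = 0" if "w \<in> M" for w
          using P(2)[OF that, of x] P(2)[OF that, of y]
          by (simp add: cinner_diff_left cinner_add_left)
      qed
      show "P (c *s x) = c *s P x"
      proof (rule uniq)
        show "c *s P x \<in> M"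
          using P(1) M by (simp add: vec.subspace_scale)
        show "cinner (c *s x - c *s P x) w = 0" if "w \<in> M" for w
          using P(2)[OF that, of x] by (simp add: cinner_diff_left cinner_scale_left)
      qed
    qed simp_all
    show "P x \<in> M" for x by (rule P(1))
    show "P x = x" if "x \<in> M" for x
      using that by (intro uniq) simp_all
    show "cinner (P x) w = cinner x w" if "w \<in> M" for x w
      using P(2)[OF that, of x] by (simp add: cinner_diff_left)
  qed
qed

section \<open>Rank one tests and faces\<close>

lemma mix_ketbra: "mix N z (ketbra w w) = of_real (\<Sum>k\<in>N. (norm (cinner (z k) w))\<^sup>2)"
  by (simp add: mix_def ketbra_bops cinner_ketbra_self)

lemma mix_ketbra_eq_0_iff:
  assumes "finite N"
  shows "mix N z (ketbra w w) = 0 \<longleftrightarrow> (\<forall>k\<in>N. cinner (z k) w = 0)"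
  unfolding mix_ketbra of_real_eq_0_iff using assms by (simp add: sum_nonneg_eq_0_iff)

text \<open>Nonnegative summands cannot cancel, so a vanishing test constrains every vector of any
  decomposition over \<open>Y\<close>. The right-hand side speaks of the functional alone.\<close>

lemma mixtures_inter_subspace_iff:
  assumes M: "vec.subspace M" and x: "x \<in> mixtures Y"
  shows "x \<in> mixtures (Y \<inter> M) \<longleftrightarrow> (\<forall>w. (\<forall>v\<in>M. cinner v w = 0) \<longrightarrow> x (ketbra w w) = 0)"
proof
  assume "x \<in> mixtures (Y \<inter> M)"
  then obtain N :: "nat set" and z where N: "finite N" "\<forall>k\<in>N. z k \<in> Y \<inter> M"
      "(\<Sum>k\<in>N. (norm (z k))\<^sup>2) = 1" "x = mix N z"
    by (rule mixturesE)
  then show "\<forall>w. (\<forall>v\<in>M. cinner v w = 0) \<longrightarrow> x (ketbra w w) = 0"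
    by (simp add: mix_ketbra_eq_0_iff)
next
  assume *: "\<forall>w. (\<forall>v\<in>M. cinner v w = 0) \<longrightarrow> x (ketbra w w) = 0"
  obtain N :: "nat set" and z where N: "finite N" "\<forall>k\<in>N. z k \<in> Y"
      "(\<Sum>k\<in>N. (norm (z k))\<^sup>2) = 1" "x = mix N z"
    using x by (rule mixturesE)
  have "z k \<in> M" if "k \<in> N" for k
    using * that unfolding in_csubspace_iff[OF M] N(4) mix_ketbra_eq_0_iff[OF N(1)] by blast
  then show "x \<in> mixtures (Y \<inter> M)"
    unfolding N(4) using N(1-3) by (intro mixturesI) auto
qed

text \<open>Evaluation at \<open>ketbra w w\<close> is affine and nonnegative on mixtures: if it
  vanishes on a proper convex combination, it vanishes on both end points. The tests with
  \<open>w\<close> orthogonal to \<open>M\<close> cut out the subset.\<close>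

lemma is_face_mixtures:
  assumes Y: "scale_closed Y" and M: "vec.subspace M"
  shows "is_face (mixtures (Y \<inter> M)) (mixtures Y)"
  unfolding is_face_def
proof (intro conjI ballI impI)
  show "mixtures (Y \<inter> M) \<subseteq> mixtures Y"
    by (rule mixtures_mono) simp
  show "fconvex (mixtures (Y \<inter> M))"
    using Y subspace_scale_closed[OF M] by (intro fconvex_mixtures) (simp add: scale_closed_def)
  fix x y :: "'a functional" and t :: real
  assume xy: "x \<in> mixtures Y" "y \<in> mixtures Y" and t: "t \<in> {0<..<1}"
    and mem: "ccomb t x y \<in> mixtures (Y \<inter> M)"
  have real_nonneg: "\<exists>r\<ge>0. u (ketbra w w) = of_real r" if "u \<in> mixtures Y" for u w
    using that by (elim mixturesE) (metis mix_ketbra sum_nonneg zero_le_power2)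
  have "x (ketbra w w) = 0 \<and> y (ketbra w w) = 0" if w: "\<forall>v\<in>M. cinner v w = 0" for w
  proof -
    obtain r s where rs: "r \<ge> 0" "x (ketbra w w) = of_real r" "s \<ge> 0" "y (ketbra w w) = of_real s"
      using real_nonneg[OF xy(1)] real_nonneg[OF xy(2)] by meson
    have "ccomb t x y \<in> mixtures Y"
      using mem mixtures_mono[of "Y \<inter> M" Y] by blast
    then have "ccomb t x y (ketbra w w) = 0"
      using mixtures_inter_subspace_iff[OF M] mem w by blast
    then have "complex_of_real (t * r + (1 - t) * s) = 0"
      by (simp add: ccomb_def rs scaleR_conv_of_real)
    then have "t * r + (1 - t) * s = 0"
      by (simp only: of_real_eq_0_iff)
    moreover have "t * r \<ge> 0" "(1 - t) * s \<ge> 0"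
      using t rs by simp_all
    ultimately have "t * r = 0" "(1 - t) * s = 0"
      by linarith+
    then show ?thesis
      using t rs by simp
  qed
  then show "x \<in> mixtures (Y \<inter> M)" "y \<in> mixtures (Y \<inter> M)"
    using mixtures_inter_subspace_iff[OF M] xy by blast+
qed

text \<open>Taking the product vectors or \<open>UNIV\<close> as \<open>Y\<close> makes the same set
  a face of S or of K.\<close>

lemma is_face_mixtures_subspace:
  assumes "scale_closed Y" "vec.subspace M" "M \<subseteq> Y"
  shows "is_face (mixtures M) (mixtures Y)"
  using is_face_mixtures[OF assms(1,2)] assms(3) by (simp add: Int_absorb1)

section \<open>Minimality of the faces\<close>

text \<open>The constant is chosen before \<open>A\<close>: the rank one operator of a linear
  combination is dominated by a multiple of the sum of the rank one operators of the
  \<open>g j\<close>.\<close>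

lemma pos_op_combination_bound:
  fixes g :: "'i \<Rightarrow> complex^'k"
  assumes "finite J"
  shows "\<exists>C\<ge>0. \<forall>A\<in>bops UNIV. pos_op UNIV A \<longrightarrow>
    Re (cinner (A (\<Sum>j\<in>J. c j *s g j)) (\<Sum>j\<in>J. c j *s g j)) \<le> C * (\<Sum>j\<in>J. Re (cinner (A (g j)) (g j)))"
  using assms
proof (induction J rule: finite_induct)
  case empty
  then show ?case by (auto simp: bops_UNIV_simps)
next
  case (insert i J)
  then obtain C where C: "C \<ge> 0" and bound: "\<And>A. A \<in> bops UNIV \<Longrightarrow> pos_op UNIV A \<Longrightarrow>
    Re (cinner (A (\<Sum>j\<in>J. c j *s g j)) (\<Sum>j\<in>J. c j *s g j)) \<le> C * (\<Sum>j\<in>J. Re (cinner (A (g j)) (g j)))"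
    by blast
  \<comment> \<open>The parallelogram law costs a factor 2 on each part; the sum of both
    coefficients bounds either of them.\<close>
  define D where "D = 2 * C + 2 * (norm (c i))\<^sup>2"
  have "Re (cinner (A (\<Sum>j\<in>insert i J. c j *s g j)) (\<Sum>j\<in>insert i J. c j *s g j))
      \<le> D * (\<Sum>j\<in>insert i J. Re (cinner (A (g j)) (g j)))"
    if A: "A \<in> bops UNIV" "pos_op UNIV A" for A
  proof -
    define q where "q x = Re (cinner (A x) x)" for x
    define y where "y = (\<Sum>j\<in>J. c j *s g j)"
    define S where "S = (\<Sum>j\<in>J. q (g j))"
    have q0: "q x \<ge> 0" for x
      using A(2) by (simp add: pos_op_def q_def)
    have par: "q (x + y) + q (x - y) = 2 * q x + 2 * q y" for x
      by (simp add: q_def bops_UNIV_simps[OF A(1)] cinner_add_left cinner_add_right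
          cinner_diff_left cinner_diff_right)
    have qi: "q (c i *s g i) = (norm (c i))\<^sup>2 * q (g i)"
    proof -
      have "cinner (A (c i *s g i)) (c i *s g i) = (c i * cnj (c i)) * cinner (A (g i)) (g i)"
        by (simp add: bops_UNIV_simps[OF A(1)] cinner_scale_left cinner_scale_right)
      then show ?thesis
        unfolding q_def complex_norm_square[symmetric] by simp
    qed
    have "q (c i *s g i + y) \<le> 2 * q (c i *s g i) + 2 * q y"
      using par[of "c i *s g i"] q0[of "c i *s g i - y"] by linarith
    also have "q y \<le> C * S"
      using bound[OF A] by (simp add: y_def S_def q_def)
    also have "2 * q (c i *s g i) + 2 * (C * S) = 2 * ((norm (c i))\<^sup>2 * q (g i)) + 2 * (C * S)"
      unfolding qi ..
    also have "\<dots> \<le> D * (q (g i) + S)"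
    proof -
      have "S \<ge> 0" using q0 by (simp add: S_def sum_nonneg)
      then have "C * q (g i) \<ge> 0" "(norm (c i))\<^sup>2 * S \<ge> 0"
        using C q0[of "g i"] by simp_all
      then show ?thesis
        by (simp add: D_def algebra_simps)
    qed
    finally show ?thesis
      using insert.hyps by (simp add: q_def y_def S_def)
  qed
  moreover have "D \<ge> 0"
    using C by (simp add: D_def)
  ultimately show ?case by blast
qed

text \<open>Every vector state from the span of the generators occurs in a proper splitting of their
  average, so a face containing the generators contains that vector state.\<close>

lemma mixtures_subset_face:
  fixes g :: "nat \<Rightarrow> complex^'k"
  assumes Y: "scale_closed Y" and L: "vec.subspace L" "L \<subseteq> Y"
    and J: "finite J" "J \<noteq> {}" and g: "\<And>j. j \<in> J \<Longrightarrow> g j \<in> L" "\<And>j. j \<in> J \<Longrightarrow> norm (g j) = 1"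
    and gen: "L \<subseteq> cspan_fam J g"
    and face: "is_face \<Phi> (mixtures Y)" and mem: "\<And>j. j \<in> J \<Longrightarrow> vstate (g j) \<in> \<Phi>"
  shows "mixtures L \<subseteq> \<Phi>"
proof (rule mixtures_subset_fconvex)
  show conv: "fconvex \<Phi>"
    using face by (simp add: is_face_def)
  show "scale_closed L"
    by (rule subspace_scale_closed[OF L(1)])
  fix z assume z: "z \<in> L" "norm z = 1"
  then obtain c where c: "z = (\<Sum>j\<in>J. c j *s g j)"
    using gen by (auto simp: cspan_fam_def)
  obtain C where C: "C \<ge> 0" and bound: "\<And>A. A \<in> bops UNIV \<Longrightarrow> pos_op UNIV A \<Longrightarrow>
    Re (cinner (A z) z) \<le> C * (\<Sum>j\<in>J. Re (cinner (A (g j)) (g j)))"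
    using pos_op_combination_bound[OF J(1), of c g] unfolding c by blast
  define n where "n = real (card J)"
  have n: "n > 0"
    using J by (simp add: n_def card_gt_0_iff)
  \<comment> \<open>The denominator gives \<open>t * C \<le> 1 / n\<close>, the bound behind the
    positivity of \<open>\<tau>\<close>; the summand 2 keeps \<open>t\<close> below 1 even for
    \<open>C = 0\<close>.\<close>
  define t where "t = 1 / (C * n + 2)"
  have "C * n \<ge> 0" using C n by simp
  then have Cn: "C * n + 2 > 0" "C * n + 2 > 1" by linarith+
  have t: "t > 0" "t < 1" "t * C \<le> 1 / n"
    using n Cn by (simp_all add: t_def field_simps)
  \<comment> \<open>The average \<open>\<rho>\<close> of the generators dominates \<open>t\<close> times the vector state of \<open>z\<close>, so it is a
    proper convex combination of that vector state and another state \<open>\<tau>\<close>.\<close>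
  define \<rho> where "\<rho> = (\<lambda>A. \<Sum>j\<in>J. (1 / n) *\<^sub>R vstate (g j) A)"
  have \<rho>_in: "\<rho> \<in> C'" if "fconvex C'" "\<And>j. j \<in> J \<Longrightarrow> vstate (g j) \<in> C'" for C'
    unfolding \<rho>_def using that J n by (intro fconvex_sum) (auto simp: n_def)
  define \<tau> where "\<tau> = (\<lambda>A. (1 / (1 - t)) *\<^sub>R (\<rho> A - t *\<^sub>R vstate z A))"
  have \<rho>_eq: "\<rho> = ccomb t (vstate z) \<tau>"
    using t by (simp add: ccomb_def \<tau>_def fun_eq_iff)
  have \<rho>_L: "\<rho> \<in> mixtures L"
    using g subspace_scale_closed[OF L(1)]
    by (intro \<rho>_in) (auto intro: fconvex_mixtures vstate_in_mixtures)
  then have \<rho>_st: "\<rho> \<in> states UNIV"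
    using mixtures_mono[of L UNIV] states_UNIV by auto
  have z_st: "vstate z \<in> states UNIV"
    using vstate_in_mixtures[of z UNIV] z states_UNIV by auto
  have "\<tau> \<in> states UNIV"
    unfolding states_def
  proof (intro CollectI conjI ballI allI impI)
    show "\<tau> A = 0" if "A \<notin> bops UNIV" for A
      using that by (simp add: \<tau>_def \<rho>_def vstate_def)
    show "\<tau> (\<lambda>x. A x + B x) = \<tau> A + \<tau> B" if "A \<in> bops UNIV" "B \<in> bops UNIV" for A B
    proof -
      have "\<rho> (\<lambda>x. A x + B x) = \<rho> A + \<rho> B" "vstate z (\<lambda>x. A x + B x) = vstate z A + vstate z B"
        using \<rho>_st z_st that unfolding states_def by blast+
      then show ?thesis
        by (simp add: \<tau>_def algebra_simps)
    qed
    show "\<tau> (\<lambda>x. c *s A x) = c * \<tau> A" if "A \<in> bops UNIV" for A c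
    proof -
      have "\<rho> (\<lambda>x. c *s A x) = c * \<rho> A" "vstate z (\<lambda>x. c *s A x) = c * vstate z A"
        using \<rho>_st z_st that unfolding states_def by blast+
      then show ?thesis
        by (simp add: \<tau>_def algebra_simps)
    qed
    show "\<tau> (idop UNIV) = 1"
    proof -
      have "\<rho> (idop UNIV) = 1" "vstate z (idop UNIV) = 1"
        using \<rho>_st z_st unfolding states_def by blast+
      then show ?thesis
        using t by (simp add: \<tau>_def complex_eq_iff)
    qed
    fix A :: "complex^'k \<Rightarrow> complex^'k" assume A: "A \<in> bops UNIV" "pos_op UNIV A"
    have "Im (\<rho> A) = 0" "Im (vstate z A) = 0"
      using \<rho>_st z_st A unfolding states_def by blast+
    then show "Im (\<tau> A) = 0"
      by (simp add: \<tau>_def)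
    have S: "(\<Sum>j\<in>J. Re (cinner (A (g j)) (g j))) \<ge> 0"
      using A by (simp add: pos_op_def sum_nonneg)
    have "t * Re (vstate z A) \<le> t * (C * (\<Sum>j\<in>J. Re (cinner (A (g j)) (g j))))"
      using bound[OF A] t A by (simp add: vstate_def)
    also have "\<dots> \<le> (1 / n) * (\<Sum>j\<in>J. Re (cinner (A (g j)) (g j)))"
      using mult_right_mono[OF t(3) S] by simp
    also have "\<dots> = Re (\<rho> A)"
      using A by (simp add: \<rho>_def vstate_def sum_distrib_left sum_divide_distrib)
    finally show "0 \<le> Re (\<tau> A)"
      using t by (simp add: \<tau>_def)
  qed
  then have \<tau>_in: "\<tau> \<in> mixtures UNIV"
    by (simp add: states_UNIV)
  \<comment> \<open>So far \<open>\<tau>\<close> is only a state in K. Since \<open>\<rho>\<close>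
    lies in this face of K, so does \<open>\<tau>\<close>, and \<open>L \<subseteq> Y\<close> brings
    it into \<open>mixtures Y\<close>, where the face property of \<open>\<Phi>\<close>
    applies.\<close>
  have "is_face (mixtures L) (mixtures UNIV)"
    by (intro is_face_mixtures_subspace) (simp_all add: scale_closed_def L)
  then have "\<tau> \<in> mixtures L"
    using \<rho>_L \<tau>_in vstate_in_mixtures[of z UNIV] z t unfolding is_face_def \<rho>_eq by force
  then have "\<tau> \<in> mixtures Y" "vstate z \<in> mixtures Y"
    using mixtures_mono[OF L(2)] vstate_in_mixtures z L(2) by blast+
  moreover have "ccomb t (vstate z) \<tau> \<in> \<Phi>"
    using \<rho>_in[OF conv mem] by (simp add: \<rho>_eq)
  moreover have "t \<in> {0<..<1}" using t by simp
  ultimately show "vstate z \<in> \<Phi>"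
    using face unfolding is_face_def by blast
qed


section \<open>State spaces of subspaces\<close>

text \<open>The vectors of such a mixture lie in \<open>L\<close>, so its values depend only on the
  compressions of operators to \<open>L\<close>. In the proof \<open>R\<close> is this compression,
  \<open>\<psi>\<close> is the pullback along it, and \<open>\<phi>\<close> is the pullback along
  the extension of A to A P.\<close>

lemma aff_iso_mixtures_states:
  fixes L :: "(complex^'k) set"
  assumes L: "vec.subspace L"
  shows "aff_iso (mixtures L) (states L)"
proof -
  obtain P where P: "P \<in> bops UNIV" "\<And>x. P x \<in> L" "\<And>x. x \<in> L \<Longrightarrow> P x = x"
    "\<And>x w. w \<in> L \<Longrightarrow> cinner (P x) w = cinner x w"
    using csubspace_projection[OF L] by blast
  note Lc = vec.subspace_add[OF L] vec.subspace_scale[OF L] vec.subspace_0[OF L]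
  define R where "R B = (\<lambda>x. if x \<in> L then P (B x) else 0)" for B
  define \<phi> :: "'k functional \<Rightarrow> 'k functional"
    where "\<phi> \<omega> = (\<lambda>A. if A \<in> bops L then \<omega> (\<lambda>x. A (P x)) else 0)" for \<omega>
  define \<psi> :: "'k functional \<Rightarrow> 'k functional"
    where "\<psi> \<sigma> = (\<lambda>B. if B \<in> bops UNIV then \<sigma> (R B) else 0)" for \<sigma>
  have AP: "(\<lambda>x. A (P x)) \<in> bops UNIV" if "A \<in> bops L" for A
    using that P(2) by (simp add: bops_def bops_UNIV_simps[OF P(1)])
  have RB: "R B \<in> bops L" if "B \<in> bops UNIV" for B
    using P(2) by (auto simp: bops_def R_def bops_UNIV_simps[OF that] bops_UNIV_simps[OF P(1)] Lc)
  have Ladd: "(\<lambda>x. A x + B x) \<in> bops L" if "A \<in> bops L" "B \<in> bops L" for A B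
    using that by (simp add: bops_def Lc vec.scale_right_distrib)
  have Lscale: "(\<lambda>x. c *s A x) \<in> bops L" if "A \<in> bops L" for A c
    using that by (simp add: bops_def Lc vec.scale_right_distrib mult.commute)
  have Lid: "idop L \<in> bops L"
    by (auto simp: bops_def idop_def Lc)
  have \<phi>_mix: "\<phi> (mix N z) A = (\<Sum>k\<in>N. cinner (A (z k)) (z k))"
    if "A \<in> bops L" "\<forall>k\<in>N. z k \<in> L" for A and N :: "nat set" and z
    using that by (simp add: \<phi>_def mix_def AP P(3))
  have "bij_betw \<phi> (mixtures L) (states L)"
  proof (rule bij_betw_byWitness[where f' = \<psi>])
    show "\<forall>\<omega>\<in>mixtures L. \<psi> (\<phi> \<omega>) = \<omega>"
    proof
      fix \<omega> assume "\<omega> \<in> mixtures L"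
      then obtain N :: "nat set" and z where N: "finite N" "\<forall>k\<in>N. z k \<in> L"
        "(\<Sum>k\<in>N. (norm (z k))\<^sup>2) = 1" "\<omega> = mix N z"
        by (rule mixturesE)
      show "\<psi> (\<phi> \<omega>) = \<omega>"
      proof
        fix B
        show "\<psi> (\<phi> \<omega>) B = \<omega> B"
        proof (cases "B \<in> bops UNIV")
          case True
          then have "\<psi> (\<phi> \<omega>) B = (\<Sum>k\<in>N. cinner (R B (z k)) (z k))"
            using \<phi>_mix[OF RB[OF True] N(2)] by (simp add: \<psi>_def N(4))
          also have "\<dots> = \<omega> B"
            using N(2) True by (simp add: N(4) mix_def R_def P(4))
          finally show ?thesis .
        next
          case False
          then show ?thesis by (simp add: \<psi>_def N(4) mix_def)
        qed
      qed
    qed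
    show "\<forall>\<sigma>\<in>states L. \<phi> (\<psi> \<sigma>) = \<sigma>"
    proof
      fix \<sigma> assume \<sigma>: "\<sigma> \<in> states L"
      have "R (\<lambda>x. A (P x)) = A" if "A \<in> bops L" for A
        using that by (auto simp: R_def P(3) bops_def fun_eq_iff)
      then show "\<phi> (\<psi> \<sigma>) = \<sigma>"
        using \<sigma> by (intro ext) (auto simp: \<phi>_def \<psi>_def AP states_def)
    qed
    show "\<phi> ` mixtures L \<subseteq> states L"
    proof
      fix \<sigma> assume "\<sigma> \<in> \<phi> ` mixtures L"
      then obtain \<omega> where \<sigma>: "\<sigma> = \<phi> \<omega>" and \<omega>: "\<omega> \<in> mixtures L" by blast
      obtain N :: "nat set" and z where N: "finite N" "\<forall>k\<in>N. z k \<in> L"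
        "(\<Sum>k\<in>N. (norm (z k))\<^sup>2) = 1" "\<omega> = mix N z"
        using \<omega> by (rule mixturesE)
      have val: "\<sigma> A = (\<Sum>k\<in>N. cinner (A (z k)) (z k))" if "A \<in> bops L" for A
        unfolding \<sigma> N(4) by (rule \<phi>_mix[OF that N(2)])
      show "\<sigma> \<in> states L"
        unfolding states_def
      proof (intro CollectI conjI ballI allI impI)
        show "\<sigma> A = 0" if "A \<notin> bops L" for A
          using that by (simp add: \<sigma> \<phi>_def)
        show "\<sigma> (\<lambda>x. A x + B x) = \<sigma> A + \<sigma> B" if "A \<in> bops L" "B \<in> bops L" for A B
          using that by (simp add: val Ladd cinner_add_left sum.distrib)
        show "\<sigma> (\<lambda>x. c *s A x) = c * \<sigma> A" if "A \<in> bops L" for A c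
          using that by (simp add: val Lscale cinner_scale_left sum_distrib_left)
        show "Im (\<sigma> A) = 0" "0 \<le> Re (\<sigma> A)" if "A \<in> bops L" "pos_op L A" for A
          using that N(2) by (simp_all add: val pos_op_def sum_nonneg)
        have "\<sigma> (idop L) = of_real (\<Sum>k\<in>N. (norm (z k))\<^sup>2)"
          using N(2) unfolding val[OF Lid] by (simp add: idop_def cinner_self)
        then show "\<sigma> (idop L) = 1"
          using N(3) by simp
      qed
    qed
    show "\<psi> ` states L \<subseteq> mixtures L"
    proof
      fix \<omega> assume "\<omega> \<in> \<psi> ` states L"
      then obtain \<sigma> where \<omega>: "\<omega> = \<psi> \<sigma>" and \<sigma>: "\<sigma> \<in> states L" by blast
      have add: "\<And>A B. A \<in> bops L \<Longrightarrow> B \<in> bops L \<Longrightarrow> \<sigma> (\<lambda>x. A x + B x) = \<sigma> A + \<sigma> B"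
        and scale: "\<And>A c. A \<in> bops L \<Longrightarrow> \<sigma> (\<lambda>x. c *s A x) = c * \<sigma> A"
        and pos: "\<And>A. A \<in> bops L \<Longrightarrow> pos_op L A \<Longrightarrow> Im (\<sigma> A) = 0 \<and> Re (\<sigma> A) \<ge> 0"
        and one: "\<sigma> (idop L) = 1"
        using \<sigma> unfolding states_def by blast+
      have "\<omega> \<in> states UNIV"
        unfolding states_def
      proof (intro CollectI conjI ballI allI impI)
        show "\<omega> A = 0" if "A \<notin> bops UNIV" for A
          using that by (simp add: \<omega> \<psi>_def)
        show "\<omega> (\<lambda>x. A x + B x) = \<omega> A + \<omega> B" if "A \<in> bops UNIV" "B \<in> bops UNIV" for A B
        proof -
          have "R (\<lambda>x. A x + B x) = (\<lambda>x. R A x + R B x)"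
            by (auto simp: R_def bops_UNIV_simps[OF P(1)])
          then show ?thesis
            using that by (simp add: \<omega> \<psi>_def bops_UNIV_add add RB)
        qed
        show "\<omega> (\<lambda>x. c *s A x) = c * \<omega> A" if "A \<in> bops UNIV" for A c
        proof -
          have "R (\<lambda>x. c *s A x) = (\<lambda>x. c *s R A x)"
            by (auto simp: R_def bops_UNIV_simps[OF P(1)])
          then show ?thesis
            using that by (simp add: \<omega> \<psi>_def bops_UNIV_scale scale RB)
        qed
        show "Im (\<omega> A) = 0" "0 \<le> Re (\<omega> A)" if A: "A \<in> bops UNIV" "pos_op UNIV A" for A
        proof -
          have "pos_op L (R A)"
            using A by (simp add: pos_op_def R_def P(4))
          then show "Im (\<omega> A) = 0" "0 \<le> Re (\<omega> A)"
            using pos[OF RB[OF A(1)]] A by (simp_all add: \<omega> \<psi>_def)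
        qed
        have "R (idop UNIV) = idop L"
          by (auto simp: R_def idop_def P(3))
        then show "\<omega> (idop UNIV) = 1"
          using one by (simp add: \<omega> \<psi>_def idop_UNIV bops_UNIV_id)
      qed
      then have "\<omega> \<in> mixtures UNIV"
        by (simp add: states_UNIV)
      \<comment> \<open>If \<open>w\<close> is orthogonal to \<open>L\<close>, its rank one operator
        compresses to 0, so the criterion for subspaces places the extended state in
        \<open>mixtures L\<close>.\<close>
      moreover have "\<omega> (ketbra w w) = 0" if w: "\<forall>v\<in>L. cinner v w = 0" for w
      proof -
        have "R (ketbra w w) = (\<lambda>x. 0 *s idop L x)"
          using w by (auto simp: R_def ketbra_def bops_UNIV_simps[OF P(1)])
        then show ?thesis
          using scale[OF Lid, of 0] by (simp add: \<omega> \<psi>_def ketbra_bops)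
      qed
      ultimately show "\<omega> \<in> mixtures L"
        using mixtures_inter_subspace_iff[OF L, of \<omega> UNIV] by simp
    qed
  qed
  moreover have "\<phi> (ccomb t x y) = ccomb t (\<phi> x) (\<phi> y)" for t x y
    by (auto simp: \<phi>_def ccomb_def)
  ultimately show ?thesis
    unfolding aff_iso_def by blast
qed

section \<open>Direct convex sums of mixtures\<close>

text \<open>The faces \<open>Fi i\<close> are identified with mixtures only for
  \<open>i \<in> {1..q}\<close>, and representations inspect no other index.\<close>

lemma direct_convex_sum_cong:
  assumes "\<And>i. i \<in> {1..q} \<Longrightarrow> Cs i = Ds i"
  shows "direct_convex_sum C q Cs \<longleftrightarrow> direct_convex_sum C q Ds"
proof -
  have "is_rep q Cs = is_rep q Ds"
    using assms by (force simp: is_rep_def fun_eq_iff)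
  then show ?thesis
    using assms by (simp add: direct_convex_sum_def)
qed

text \<open>The \<open>Q i\<close> behave on the blocks like the projections of a direct sum and may
  be oblique. Existence comes from grouping the vectors by block, with the summed squared norms as
  weights.\<close>

lemma direct_convex_sum_mixtures:
  fixes L :: "nat \<Rightarrow> (complex^'k) set"
  assumes sc: "\<And>i. i \<in> {1..q} \<Longrightarrow> scale_closed (L i)"
    and Q: "\<And>i. i \<in> {1..q} \<Longrightarrow> Q i \<in> bops UNIV"
    and QL: "\<And>i j z. i \<in> {1..q} \<Longrightarrow> j \<in> {1..q} \<Longrightarrow> z \<in> L j \<Longrightarrow> Q i z = (if i = j then z else 0)"
  shows "direct_convex_sum (mixtures (\<Union>i\<in>{1..q}. L i)) q (\<lambda>i. mixtures (L i))"
  unfolding direct_convex_sum_def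
proof (intro conjI ballI)
  show "mixtures (L i) \<subseteq> mixtures (\<Union>i\<in>{1..q}. L i)" if "i \<in> {1..q}" for i
    using that by (intro mixtures_mono) auto
  show "fconvex (mixtures (L i))" if "i \<in> {1..q}" for i
    using sc[OF that] by (rule fconvex_mixtures)
next
  fix x assume "x \<in> mixtures (\<Union>i\<in>{1..q}. L i)"
  then obtain N :: "nat set" and z where N: "finite N" "\<forall>k\<in>N. z k \<in> (\<Union>i\<in>{1..q}. L i)"
      "(\<Sum>k\<in>N. (norm (z k))\<^sup>2) = 1" "x = mix N z"
    by (rule mixturesE)
  then have "\<forall>k\<in>N. \<exists>i. i \<in> {1..q} \<and> z k \<in> L i"
    by blast
  \<comment> \<open>The vector 0 may lie in several blocks; any choice is fine because it carries no
    weight.\<close>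
  then obtain idx where idx: "\<And>k. k \<in> N \<Longrightarrow> idx k \<in> {1..q}" "\<And>k. k \<in> N \<Longrightarrow> z k \<in> L (idx k)"
    by metis
  define Ni where "Ni i = {k \<in> N. idx k = i}" for i
  define lam where "lam i = (\<Sum>k\<in>Ni i. (norm (z k))\<^sup>2)" for i
  \<comment> \<open>Coefficients of a representation must be positive, so blocks of weight 0 are
    dropped.\<close>
  define I where "I = {i \<in> {1..q}. lam i > 0}"
  define w where "w i = mix (Ni i) (\<lambda>k. of_real (1 / sqrt (lam i)) *s z k)" for i
  have finNi: "finite (Ni i)" for i
    using N(1) by (simp add: Ni_def)
  have lam0: "lam i \<ge> 0" for i
    by (simp add: lam_def sum_nonneg)
  have group: "(\<Sum>i\<in>{1..q}. sum h (Ni i)) = sum h N" for h :: "nat \<Rightarrow> 'c::comm_monoid_add"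
    unfolding Ni_def using N(1) idx(1) by (intro sum.group) auto
  have "is_rep q (\<lambda>i. mixtures (L i)) x I lam w"
    unfolding is_rep_def
  proof (intro conjI ballI)
    show "I \<subseteq> {1..q}" by (auto simp: I_def)
    show "lam i > 0" if "i \<in> I" for i using that by (simp add: I_def)
    show "w i \<in> mixtures (L i)" if "i \<in> I" for i
      unfolding w_def
    proof (rule mixturesI)
      have "(\<Sum>k\<in>Ni i. (norm (complex_of_real (1 / sqrt (lam i)) *s z k))\<^sup>2) =
          (\<Sum>k\<in>Ni i. (norm (z k))\<^sup>2 / lam i)"
        using lam0[of i]
        by (intro sum.cong) (simp_all add: norm_vector_scalar_mult norm_divide power_divide)
      also have "\<dots> = 1"
        using that by (simp add: I_def flip: sum_divide_distrib) (simp add: lam_def)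
      finally show "(\<Sum>k\<in>Ni i. (norm (complex_of_real (1 / sqrt (lam i)) *s z k))\<^sup>2) = 1" .
      show "(\<lambda>k. complex_of_real (1 / sqrt (lam i)) *s z k) ` Ni i \<subseteq> L i"
        using sc[of i] that idx(2) by (auto simp: I_def Ni_def scale_closed_def)
    qed (rule finNi)
    have "(\<Sum>i\<in>I. lam i) = (\<Sum>i\<in>{1..q}. lam i)"
      using lam0 by (intro sum.mono_neutral_left) (auto simp: I_def order_less_le)
    then show "(\<Sum>i\<in>I. lam i) = 1"
      using group[of "\<lambda>k. (norm (z k))\<^sup>2"] N(3) by (simp add: lam_def)
    show "x = csum_expr I lam w"
    proof
      fix A
      show "x A = csum_expr I lam w A"
      proof (cases "A \<in> bops UNIV")
        case True
        have "lam i *\<^sub>R w i A = (\<Sum>k\<in>Ni i. cinner (A (z k)) (z k))" if "i \<in> I" for i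
        proof -
          have "lam i > 0" using that by (simp add: I_def)
          then have "complex_of_real (lam i) * (1 / of_real (sqrt (lam i)) * (1 / of_real (sqrt (lam i)) * a)) = a" for a
            by (simp add: field_simps flip: of_real_mult)
          then show ?thesis
            by (simp add: w_def mix_def True bops_UNIV_simps[OF True] cinner_scale_left
                cinner_scale_right scaleR_conv_of_real sum_distrib_left)
        qed
        then have "csum_expr I lam w A = (\<Sum>i\<in>I. \<Sum>k\<in>Ni i. cinner (A (z k)) (z k))"
          by (simp add: csum_expr_def)
        also have "\<dots> = (\<Sum>i\<in>{1..q}. \<Sum>k\<in>Ni i. cinner (A (z k)) (z k))"
        proof (rule sum.mono_neutral_left)
          show "\<forall>i\<in>{1..q} - I. (\<Sum>k\<in>Ni i. cinner (A (z k)) (z k)) = 0"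
          proof
            fix i assume "i \<in> {1..q} - I"
            then have "lam i = 0"
              using lam0[of i] by (auto simp: I_def)
            then have "\<forall>k\<in>Ni i. z k = 0"
              using finNi[of i] by (simp add: lam_def sum_nonneg_eq_0_iff)
            then show "(\<Sum>k\<in>Ni i. cinner (A (z k)) (z k)) = 0" by simp
          qed
        qed (auto simp: I_def)
        also have "\<dots> = x A"
          using True unfolding group by (simp add: N(4) mix_def)
        finally show ?thesis by simp
      next
        case False
        then show ?thesis by (simp add: N(4) csum_expr_def w_def mix_def)
      qed
    qed
  qed
  then show "\<exists>I lam w. is_rep q (\<lambda>i. mixtures (L i)) x I lam w" by blast
next
  fix x
  \<comment> \<open>Evaluating at \<open>A \<circ> Q i\<close> isolates the \<open>i\<close>-th summand.\<close>
  have eval: "x (\<lambda>y. A (Q i y)) = (if i \<in> I then lam i *\<^sub>R w i A else 0)"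
    if rep: "is_rep q (\<lambda>i. mixtures (L i)) x I lam w" and i: "i \<in> {1..q}" and A: "A \<in> bops UNIV"
    for I lam w i A
  proof -
    have I: "I \<subseteq> {1..q}" and w: "\<And>j. j \<in> I \<Longrightarrow> w j \<in> mixtures (L j)" and x: "x = csum_expr I lam w"
      using rep by (auto simp: is_rep_def)
    have AQ: "(\<lambda>y. A (Q i y)) \<in> bops UNIV"
      using A Q[OF i] by (rule bops_UNIV_compose)
    have "w j (\<lambda>y. A (Q i y)) = (if i = j then w j A else 0)" if j: "j \<in> I" for j
    proof -
      obtain N :: "nat set" and z where N: "finite N" "\<forall>k\<in>N. z k \<in> L j"
          "(\<Sum>k\<in>N. (norm (z k))\<^sup>2) = 1" "w j = mix N z"
        using w[OF j] by (rule mixturesE)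
      have "Q i (z k) = (if i = j then z k else 0)" if "k \<in> N" for k
        using QL[OF i] I j N(2) that by blast
      then show ?thesis
        using AQ A by (simp add: N(4) mix_def bops_UNIV_simps[OF A])
    qed
    then have "x (\<lambda>y. A (Q i y)) = (\<Sum>j\<in>I. if i = j then lam j *\<^sub>R w j A else 0)"
      unfolding x csum_expr_def by (intro sum.cong) auto
    moreover have "finite I"
      using I finite_subset by blast
    ultimately show ?thesis by simp
  qed
  \<comment> \<open>At the identity every summand has value 1, so the weights can be read off from
    \<open>x\<close> before the summands are compared.\<close>
  have lam_eq: "(if i \<in> I then lam i else 0) = Re (x (Q i))"
    if rep: "is_rep q (\<lambda>i. mixtures (L i)) x I lam w" and i: "i \<in> {1..q}" for I lam w i
  proof -
    have "w i (\<lambda>y. y) = 1" if "i \<in> I"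
    proof -
      have "w i \<in> mixtures UNIV"
        using rep that mixtures_mono[of "L i" UNIV] by (auto simp: is_rep_def)
      then show ?thesis
        using mixtures_UNIV_subset_states by (auto simp: states_def idop_UNIV)
    qed
    then show ?thesis
      using eval[OF rep i bops_UNIV_id] by simp
  qed
  show "\<forall>I lam w I' lam' w'. is_rep q (\<lambda>i. mixtures (L i)) x I lam w \<and>
      is_rep q (\<lambda>i. mixtures (L i)) x I' lam' w' \<longrightarrow>
      I = I' \<and> (\<forall>i\<in>I. lam i = lam' i \<and> w i = w' i)"
  proof (intro allI impI, elim conjE)
    fix I lam w I' lam' w'
    assume rep: "is_rep q (\<lambda>i. mixtures (L i)) x I lam w"
      and rep': "is_rep q (\<lambda>i. mixtures (L i)) x I' lam' w'"
    have sub: "I \<subseteq> {1..q}" "I' \<subseteq> {1..q}" and pos: "\<And>i. i \<in> I \<Longrightarrow> lam i > 0" "\<And>i. i \<in> I' \<Longrightarrow> lam' i > 0"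
      using rep rep' by (auto simp: is_rep_def)
    have eq: "(if i \<in> I then lam i else 0) = (if i \<in> I' then lam' i else 0)" if "i \<in> {1..q}" for i
      using lam_eq[OF rep that] lam_eq[OF rep' that] by simp
    have "i \<in> I \<longleftrightarrow> i \<in> I'" if "i \<in> {1..q}" for i
      using eq[OF that] pos[of i] by (auto split: if_splits)
    then have II': "I = I'" using sub by blast
    moreover have "lam i = lam' i \<and> w i = w' i" if i: "i \<in> I" for i
    proof
      have iq: "i \<in> {1..q}" using i sub by blast
      show l: "lam i = lam' i" using eq[OF iq] i II' by simp
      show "w i = w' i"
      proof
        fix A
        have mem: "w i \<in> mixtures (L i)" "w' i \<in> mixtures (L i)"
          using rep rep' i II' by (auto simp: is_rep_def)
        show "w i A = w' i A"
        proof (cases "A \<in> bops UNIV")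
          case True
          have "lam i *\<^sub>R w i A = lam' i *\<^sub>R w' i A"
            using eval[OF rep iq True] eval[OF rep' iq True] i II' by simp
          then show ?thesis
            using l pos(1)[OF i] by simp
        next
          case False
          then show ?thesis
            using mem by (auto elim!: mixturesE simp: mix_def)
        qed
      qed
    qed
    ultimately show "I = I' \<and> (\<forall>i\<in>I. lam i = lam' i \<and> w i = w' i)" by blast
  qed
qed


section \<open>Product vectors\<close>

lemma tens_scale_left: "tens (c *s x) y = c *s tens x y"
  and tens_scale_right: "tens x (c *s y) = c *s tens x y"
  and tens_add_right: "tens x (y + y') = tens x y + tens x y'"
  and tens_zero_right: "tens x 0 = 0"
  by (simp_all add: tens_def vec_eq_iff algebra_simps)

lemma linear_tens: "Vector_Spaces.linear (*s) (*s) (tens x)"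
  by (simp add: Vector_Spaces.linear_iff vec.vector_space_axioms tens_scale_right tens_add_right)

lemma tens_sum_right: "tens x (\<Sum>j\<in>J. g j) = (\<Sum>j\<in>J. tens x (g j))"
  by (induction J rule: infinite_finite_induct) (simp_all add: tens_zero_right tens_add_right)

lemma cinner_tens: "cinner (tens a b) (tens c d) = cinner a c * cinner b d"
proof -
  have "cinner (tens a b) (tens c d) =
      (\<Sum>(i, j)\<in>UNIV \<times> UNIV. (a $ i * cnj (c $ i)) * (b $ j * cnj (d $ j)))"
    unfolding cinner_def by (intro sum.cong) (auto simp: tens_def)
  then show ?thesis
    by (simp add: cinner_def sum_product sum.cartesian_product)
qed

lemma norm_tens: "norm (tens a b) = norm a * norm b"
proof -
  have "complex_of_real ((norm (tens a b))\<^sup>2) = complex_of_real ((norm a * norm b)\<^sup>2)"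
    unfolding cinner_self[symmetric] cinner_tens by (simp add: cinner_self power_mult_distrib)
  then have "(norm (tens a b))\<^sup>2 = (norm a * norm b)\<^sup>2"
    by (simp only: of_real_eq_iff)
  then show ?thesis
    by (simp add: power2_eq_iff_nonneg)
qed

lemma tens_eqD:
  assumes "tens a b = tens c d" "b \<noteq> 0"
  shows "\<exists>k. a = k *s c"
proof -
  obtain l where l: "b $ l \<noteq> 0"
    using assms(2) by (auto simp: vec_eq_iff)
  have "a $ i * b $ l = c $ i * d $ l" for i
    using arg_cong[OF assms(1), of "\<lambda>z. z $ (i, l)"] by (simp add: tens_def)
  then have "a = (d $ l / b $ l) *s c"
    using l by (simp add: vec_eq_iff field_simps)
  then show ?thesis ..
qed

definition product_vectors :: "(complex^('m::finite \<times> 'n::finite)) set" where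
  "product_vectors = {tens x y | x y. True}"

lemma scale_closed_product_vectors: "scale_closed product_vectors"
  by (auto simp: scale_closed_def product_vectors_def) (metis tens_scale_left)

lemma Sst_eq_mixtures: "(Sst :: ('m::finite \<times> 'n::finite) functional set) = mixtures product_vectors"
proof
  have "{vstate (tens x y) | (x :: complex^'m) (y :: complex^'n). unit_vec x \<and> unit_vec y}
      \<subseteq> mixtures product_vectors"
    by (auto simp: unit_vec_iff norm_tens product_vectors_def intro!: vstate_in_mixtures)
  then show "(Sst :: ('m \<times> 'n) functional set) \<subseteq> mixtures product_vectors"
    unfolding Sst_def fconvex_hull_def
    using fconvex_mixtures[OF scale_closed_product_vectors] by blast
next
  have "mixtures product_vectors \<subseteq> C"
    if C: "fconvex C" and sub: "{vstate (tens x y) | (x :: complex^'m) (y :: complex^'n).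
      unit_vec x \<and> unit_vec y} \<subseteq> C" for C
  proof (rule mixtures_subset_fconvex[OF C scale_closed_product_vectors])
    fix z :: "complex^('m \<times> 'n)" assume "z \<in> product_vectors" and n: "norm z = 1"
    then obtain x y where z: "z = tens x y"
      by (auto simp: product_vectors_def)
    \<comment> \<open>The norms of the factors have product 1 but need not be 1; the norm of
      \<open>x\<close> is moved over to \<open>y\<close>.\<close>
    define x' y' where "x' = of_real (1 / norm x) *s x" and "y' = of_real (norm x) *s y"
    have xy: "norm x * norm y = 1"
      using n by (simp add: z norm_tens)
    then have "norm x \<noteq> 0" by auto
    then have "z = tens x' y'" "unit_vec x'" "unit_vec y'"
      using xy by (simp_all add: z x'_def y'_def tens_scale_left tens_scale_right unit_vec_iff
          norm_vector_scalar_mult norm_divide)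
    then show "vstate z \<in> C"
      using sub by blast
  qed
  then show "mixtures product_vectors \<subseteq> (Sst :: ('m \<times> 'n) functional set)"
    unfolding Sst_def fconvex_hull_def by blast
qed

text \<open>The operator \<open>1 \<otimes> R\<close>: a vector is read as a matrix, and
  \<open>R\<close> acts on each row.\<close>

definition id_tens ::
  "(complex^'n \<Rightarrow> complex^'n) \<Rightarrow> complex^('m::finite \<times> 'n::finite) \<Rightarrow> complex^('m \<times> 'n)" where
  "id_tens R z = (\<chi> k. R (\<chi> l. z $ (fst k, l)) $ snd k)"

lemma id_tens_bops:
  fixes R :: "complex^'n \<Rightarrow> complex^'n"
  assumes "R \<in> bops UNIV"
  shows "(id_tens R :: complex^('m::finite \<times> 'n) \<Rightarrow> _) \<in> bops UNIV"
proof -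
  have slice: "(\<chi> l. (x + y) $ (i, l)) = (\<chi> l. x $ (i, l)) + (\<chi> l. y $ (i, l))"
    "(\<chi> l. (c *s x) $ (i, l)) = c *s (\<chi> l. x $ (i, l))"
    for x y :: "complex^('m \<times> 'n)" and i c
    by (simp_all add: vec_eq_iff)
  have "id_tens R (x + y) = id_tens R x + id_tens R y" "id_tens R (c *s x) = c *s id_tens R x"
    for x y :: "complex^('m \<times> 'n)" and c
    unfolding id_tens_def slice bops_UNIV_simps[OF assms] by (simp_all add: vec_eq_iff)
  then show ?thesis
    by (simp add: bops_def)
qed

lemma id_tens_tens:
  assumes "R \<in> bops UNIV"
  shows "id_tens R (tens x y) = tens x (R y)"
proof -
  have slice: "(\<chi> l. tens x y $ (i, l)) = x $ i *s y" for i
    by (simp add: vec_eq_iff tens_def)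
  show ?thesis
    unfolding id_tens_def slice bops_UNIV_simps[OF assms] by (simp add: tens_def)
qed

section \<open>Lines, spans and block projections\<close>

lemma cline_eqD:
  assumes "cline x = cline y"
  shows "\<exists>c. x = c *s y"
proof -
  have "x \<in> cline x"
    unfolding cline_def by (rule range_eqI[of _ _ 1]) simp
  then show ?thesis
    using assms by (auto simp: cline_def)
qed

lemma cline_eqI:
  assumes "x = c *s y" "x \<noteq> 0"
  shows "cline x = cline y"
proof -
  have "c \<noteq> 0" using assms by auto
  then have "a *s x = (a * c) *s y" "a *s y = (a / c) *s x" for a
    using assms by simp_all
  then have "a *s x \<in> cline y" "a *s y \<in> cline x" for a
    unfolding cline_def by (metis rangeI)+
  then show ?thesis
    unfolding cline_def by blast
qed

lemma subspace_cspan_fam: "vec.subspace (cspan_fam J v)"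
proof (rule vec.subspaceI)
  show "0 \<in> cspan_fam J v"
    by (auto simp: cspan_fam_def intro!: exI[of _ "\<lambda>_. 0"])
  fix x y assume "x \<in> cspan_fam J v" "y \<in> cspan_fam J v"
  then obtain c d where cd: "x = (\<Sum>j\<in>J. c j *s v j)" "y = (\<Sum>j\<in>J. d j *s v j)"
    by (auto simp: cspan_fam_def)
  show "x + y \<in> cspan_fam J v"
    unfolding cspan_fam_def cd
    by (intro CollectI exI[of _ "\<lambda>j. c j + d j"]) (simp add: vec.scale_left_distrib sum.distrib)
next
  fix c x assume "x \<in> cspan_fam J v"
  then obtain d where d: "x = (\<Sum>j\<in>J. d j *s v j)"
    by (auto simp: cspan_fam_def)
  show "c *s x \<in> cspan_fam J v"
    unfolding cspan_fam_def d
    by (intro CollectI exI[of _ "\<lambda>j. c * d j"]) (simp add: vec.scale_sum_right)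
qed

lemma cspan_fam_base:
  assumes "finite J" "j \<in> J"
  shows "v j \<in> cspan_fam J v"
proof -
  have "(\<Sum>i\<in>J. (if i = j then 1 else 0) *s v i) = (\<Sum>i\<in>J. if i = j then v i else 0)"
    by (intro sum.cong) auto
  also have "\<dots> = v j"
    using assms by simp
  finally show ?thesis
    unfolding cspan_fam_def by (intro CollectI exI[of _ "\<lambda>i. if i = j then 1 else 0"]) simp
qed

text \<open>A linear map may be prescribed freely on an independent set. Independence is given here
  for a family, so injectivity is established before passing to its image.\<close>

lemma clin_indep_block_projection:
  assumes indep: "clin_indep p f"
  obtains R where "R \<in> bops UNIV" "\<And>j. j \<in> {1..p} \<Longrightarrow> R (f j) = (if j \<in> J then f j else 0)"
proof -
  have inj: "inj_on f {1..p}"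
  proof (rule inj_onI, rule ccontr)
    fix i j assume ij: "i \<in> {1..p}" "j \<in> {1..p}" "f i = f j" "i \<noteq> j"
    \<comment> \<open>Equal vectors at two indices would be related by the coefficients 1 and
      -1.\<close>
    define c :: "nat \<Rightarrow> complex" where "c k = (if k = i then 1 else 0) - (if k = j then 1 else 0)" for k
    have "(\<Sum>k\<in>{1..p}. c k *s f k) =
        (\<Sum>k\<in>{1..p}. if k = i then f k else 0) - (\<Sum>k\<in>{1..p}. if k = j then f k else 0)"
      unfolding sum_subtractf[symmetric] c_def
      by (intro sum.cong) (auto simp: vec.scale_left_diff_distrib)
    also have "\<dots> = 0"
      using ij by simp
    finally have "c i = 0"
      using indep ij(1) unfolding clin_indep_def by blast
    then show False
      using ij(4) by (simp add: c_def)
  qed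
  have "vec.independent (f ` {1..p})"
  proof (rule vec.independent_if_scalars_zero)
    fix g x assume s: "(\<Sum>x\<in>f ` {1..p}. g x *s x) = 0" and x: "x \<in> f ` {1..p}"
    have "(\<Sum>j\<in>{1..p}. g (f j) *s f j) = 0"
      using s unfolding sum.reindex[OF inj] by simp
    then show "g x = 0"
      using indep x unfolding clin_indep_def by auto
  qed simp
  then obtain R where R: "Vector_Spaces.linear (*s) (*s) R"
    "\<forall>x\<in>f ` {1..p}. R x = (if x \<in> f ` (J \<inter> {1..p}) then x else 0)"
    using vec.linear_independent_extend[of _ "\<lambda>x. if x \<in> f ` (J \<inter> {1..p}) then x else 0"] by blast
  have "f j \<in> f ` (J \<inter> {1..p}) \<longleftrightarrow> j \<in> J" if "j \<in> {1..p}" for j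
    using inj that by (auto dest: inj_onD)
  then show thesis
    using R by (intro that[of R]) (simp_all add: bops_UNIV_iff)
qed

text \<open>Applying \<open>1 \<otimes> R i\<close> to a product vector \<open>a \<otimes> b\<close> of the sum space gives \<open>a \<otimes> R i b\<close>, which
  lies in \<open>e i \<otimes> V i\<close>. So \<open>a\<close> is proportional to \<open>e i\<close> whenever \<open>R i b \<noteq> 0\<close>, which can happen for
  one \<open>i\<close> only.\<close>

lemma product_vector_in_span_blocks:
  fixes e :: "nat \<Rightarrow> complex^'m" and V :: "nat \<Rightarrow> (complex^'n) set"
  assumes I: "finite I"
    and dist: "\<And>i j. i \<in> I \<Longrightarrow> j \<in> I \<Longrightarrow> i \<noteq> j \<Longrightarrow> cline (e i) \<noteq> cline (e j)"
    and V: "\<And>i. i \<in> I \<Longrightarrow> vec.subspace (V i)"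
    and R: "\<And>i. i \<in> I \<Longrightarrow> R i \<in> bops UNIV"
    and RV: "\<And>i j v. i \<in> I \<Longrightarrow> j \<in> I \<Longrightarrow> v \<in> V j \<Longrightarrow> R i v = (if i = j then v else 0)"
    and z: "tens a b \<in> vec.span (\<Union>i\<in>I. tens (e i) ` V i)" and nz: "tens a b \<noteq> 0"
  shows "\<exists>i\<in>I. tens a b \<in> tens (e i) ` V i"
proof -
  define L where "L i = tens (e i) ` V i" for i
  define Q where "Q i = (id_tens (R i) :: complex^('m \<times> 'n) \<Rightarrow> _)" for i
  have "Q i \<in> bops UNIV" if "i \<in> I" for i
    unfolding Q_def by (rule id_tens_bops[OF R[OF that]])
  note Qs = bops_UNIV_simps[OF this]
  have L: "vec.subspace (L i)" if "i \<in> I" for i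
    unfolding L_def by (rule vec.linear_subspace_image[OF linear_tens V[OF that]])
  have QL: "Q i x = (if i = j then x else 0)" if "i \<in> I" "j \<in> I" "x \<in> L j" for i j x
    using that RV by (auto simp: L_def Q_def id_tens_tens[OF R] tens_zero_right)
  \<comment> \<open>Both properties hold on each block and are linear in \<open>x\<close>, so they
    pass to the span.\<close>
  have "(\<forall>i\<in>I. Q i x \<in> L i) \<and> x = (\<Sum>i\<in>I. Q i x)" if "x \<in> vec.span (\<Union>i\<in>I. L i)" for x
    using that
  proof (rule vec.span_induct)
    show "vec.subspace {x. (\<forall>i\<in>I. Q i x \<in> L i) \<and> x = (\<Sum>i\<in>I. Q i x)}"
    proof (rule vec.subspaceI)
      show "0 \<in> {x. (\<forall>i\<in>I. Q i x \<in> L i) \<and> x = (\<Sum>i\<in>I. Q i x)}"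
        by (simp add: Qs vec.subspace_0 L)
      fix x y assume "x \<in> {x. (\<forall>i\<in>I. Q i x \<in> L i) \<and> x = (\<Sum>i\<in>I. Q i x)}"
        "y \<in> {x. (\<forall>i\<in>I. Q i x \<in> L i) \<and> x = (\<Sum>i\<in>I. Q i x)}"
      moreover have "(\<Sum>i\<in>I. Q i (x + y)) = (\<Sum>i\<in>I. Q i x) + (\<Sum>i\<in>I. Q i y)"
        by (simp add: Qs sum.distrib)
      ultimately show "x + y \<in> {x. (\<forall>i\<in>I. Q i x \<in> L i) \<and> x = (\<Sum>i\<in>I. Q i x)}"
        by (auto simp: Qs vec.subspace_add L)
    next
      fix c x assume "x \<in> {x. (\<forall>i\<in>I. Q i x \<in> L i) \<and> x = (\<Sum>i\<in>I. Q i x)}"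
      moreover have "(\<Sum>i\<in>I. Q i (c *s x)) = c *s (\<Sum>i\<in>I. Q i x)"
        by (simp add: Qs vec.scale_sum_right)
      ultimately show "c *s x \<in> {x. (\<forall>i\<in>I. Q i x \<in> L i) \<and> x = (\<Sum>i\<in>I. Q i x)}"
        by (auto simp: Qs vec.subspace_scale L)
    qed
    fix x assume "x \<in> (\<Union>i\<in>I. L i)"
    then obtain j where j: "j \<in> I" "x \<in> L j" by blast
    have "(\<Sum>i\<in>I. Q i x) = (\<Sum>i\<in>I. if i = j then x else 0)"
      using QL j by (intro sum.cong) auto
    then show "(\<forall>i\<in>I. Q i x \<in> L i) \<and> x = (\<Sum>i\<in>I. Q i x)"
      using I j QL[OF _ j] by (auto simp: vec.subspace_0 L)
  qed
  from this[of "tens a b"] z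
  have mem: "\<And>i. i \<in> I \<Longrightarrow> Q i (tens a b) \<in> L i" and eq: "tens a b = (\<Sum>i\<in>I. Q i (tens a b))"
    by (auto simp: L_def)
  have line: "cline a = cline (e i)" if i: "i \<in> I" "Q i (tens a b) \<noteq> 0" for i
  proof -
    have Qi: "Q i (tens a b) = tens a (R i b)"
      by (simp add: Q_def id_tens_tens[OF R[OF i(1)]])
    have "R i b \<noteq> 0"
      using i(2) by (auto simp: Qi tens_zero_right)
    moreover obtain v where "tens a (R i b) = tens (e i) v"
      using mem[OF i(1)] by (auto simp: Qi L_def)
    ultimately obtain k where k: "a = k *s e i"
      using tens_eqD by blast
    have "a \<noteq> 0"
      using nz norm_tens[of a b] by auto
    with k show ?thesis
      by (rule cline_eqI)
  qed
  obtain i where i: "i \<in> I" "Q i (tens a b) \<noteq> 0"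
    using eq nz by (metis sum.neutral)
  have "Q j (tens a b) = 0" if "j \<in> I" "j \<noteq> i" for j
    using line[OF i] line[of j] dist[of i j] that i(1) by metis
  then have "(\<Sum>j\<in>I. Q j (tens a b)) = (\<Sum>j\<in>I. if j = i then Q i (tens a b) else 0)"
    by (intro sum.cong) auto
  then have "tens a b = Q i (tens a b)"
    using eq I i(1) by simp
  then show ?thesis
    using mem[OF i(1)] i(1) by (auto simp: L_def)
qed


section \<open>Assembling the theorem\<close>

lemma face_gen_eqI:
  assumes "is_face G C" "X \<subseteq> G" "\<And>\<Phi>. is_face \<Phi> C \<Longrightarrow> X \<subseteq> \<Phi> \<Longrightarrow> G \<subseteq> \<Phi>"
  shows "face_gen C X = G"
  using assms unfolding face_gen_def by blast

text \<open>Scaling a vector by \<open>c\<close> multiplies its functional by the square of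
  \<open>norm c\<close>, so all unit vectors of a line give one and the same state.\<close>

lemma mixtures_single_line:
  assumes "norm g = 1" and "L \<subseteq> cline g" and "g \<in> L"
  shows "mixtures L = {vstate g}"
proof
  show "mixtures L \<subseteq> {vstate g}"
  proof
    fix x assume "x \<in> mixtures L"
    then obtain N :: "nat set" and z where N: "finite N" "\<forall>k\<in>N. z k \<in> L"
        "(\<Sum>k\<in>N. (norm (z k))\<^sup>2) = 1" "x = mix N z"
      by (rule mixturesE)
    then have "\<forall>k\<in>N. \<exists>c. z k = c *s g"
      using assms(2) by (auto simp: cline_def)
    then obtain c where c: "\<And>k. k \<in> N \<Longrightarrow> z k = c k *s g" by metis
    have nz: "(norm (z k))\<^sup>2 = (norm (c k))\<^sup>2" if "k \<in> N" for k
      using c[OF that] assms(1) by (simp add: norm_vector_scalar_mult)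
    have "mix N z A = vstate g A" for A
    proof (cases "A \<in> bops UNIV")
      case True
      have "cinner (A (z k)) (z k) = of_real ((norm (z k))\<^sup>2) * cinner (A g) g" if "k \<in> N" for k
      proof -
        have "cinner (A (z k)) (z k) = (c k * cnj (c k)) * cinner (A g) g"
          by (simp add: c[OF that] bops_UNIV_simps[OF True] cinner_scale_left cinner_scale_right)
        then show ?thesis
          unfolding complex_norm_square[symmetric] nz[OF that] .
      qed
      then have "mix N z A = of_real (\<Sum>k\<in>N. (norm (z k))\<^sup>2) * cinner (A g) g"
        using True by (simp add: mix_def sum_distrib_right)
      then show ?thesis
        using N(3) True by (simp add: vstate_def)
    qed (simp add: mix_def vstate_def)
    then show "x \<in> {vstate g}"
      using N(4) by (auto simp: fun_eq_iff)
  qed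
  show "{vstate g} \<subseteq> mixtures L"
    using assms vstate_in_mixtures by blast
qed

theorem mainTheorem4:
  fixes e :: "nat \<Rightarrow> complex^'m" and f :: "nat \<Rightarrow> complex^'n" and p q :: nat
  assumes e_unit: "\<forall>i\<in>{1..p}. unit_vec (e i)"
      and f_unit: "\<forall>i\<in>{1..p}. unit_vec (f i)"
      and f_indep: "clin_indep p f"
      and qp: "q \<le> p"
      and e_dist: "\<forall>i\<in>{1..q}. \<forall>j\<in>{1..q}. i \<noteq> j \<longrightarrow> cline (e i) \<noteq> cline (e j)"
      and e_rest: "\<forall>i\<in>{q<..p}. \<exists>j\<in>{1..q}. cline (e i) = cline (e j)"
  defines "Fi \<equiv> (\<lambda>i. face_gen (Sst :: ('m \<times> 'n) functional set)
                   {vstate (tens (e j) (f j)) | j. j \<in> {1..p} \<and> cline (e j) = cline (e i)})"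
      and "L \<equiv> (\<lambda>i. {tens (e i) v | v. v \<in> cspan_fam {j \<in> {1..p}. cline (e j) = cline (e i)} f})"
      and "F \<equiv> face_gen (Sst :: ('m \<times> 'n) functional set) {vstate (tens (e i) (f i)) | i. i \<in> {1..p}}"
  shows "(\<forall>i\<in>{1..q}. is_face (Fi i) Kst)
       \<and> (\<forall>i\<in>{1..q}. aff_iso (Fi i) (states (L i)))
       \<and> direct_convex_sum F q Fi
       \<and> ((\<forall>i\<in>{1..p}. \<forall>j\<in>{1..p}. i \<noteq> j \<longrightarrow> cline (e i) \<noteq> cline (e j)) \<longrightarrow>
            F = fconvex_hull {vstate (tens (e i) (f i)) | i. i \<in> {1..p}} \<and> is_simplex F)"
proof -
  define J where "J i = {j \<in> {1..p}. cline (e j) = cline (e i)}" for i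
  define V where "V i = cspan_fam (J i) f" for i
  define U where "U = (\<Union>i\<in>{1..q}. L i)"
  define g where "g j = tens (e j) (f j)" for j
  have iJ: "i \<in> J i" if "i \<in> {1..p}" for i
    using that by (simp add: J_def)
  have finJ: "finite (J i)" for i
    by (simp add: J_def)
  have q_p: "i \<in> {1..p}" if "i \<in> {1..q}" for i
    using that qp by simp
  have J_cover: "\<exists>i\<in>{1..q}. j \<in> J i" if "j \<in> {1..p}" for j
    using that e_rest by (cases "j \<le> q") (auto simp: J_def)
  have J_disjoint: "i = k" if "j \<in> J i" "j \<in> J k" "i \<in> {1..q}" "k \<in> {1..q}" for i j k
  proof -
    have "cline (e i) = cline (e k)"
      using that(1,2) by (simp add: J_def)
    then show ?thesis
      using e_dist that(3,4) by blast
  qed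
  have L_eq: "L i = tens (e i) ` V i" for i
    by (auto simp: L_def V_def J_def)
  have V_sub: "vec.subspace (V i)" for i
    unfolding V_def by (rule subspace_cspan_fam)
  have L_sub: "vec.subspace (L i)" for i
    unfolding L_eq by (rule vec.linear_subspace_image[OF linear_tens V_sub])
  have L_prod: "L i \<subseteq> product_vectors" for i
    by (auto simp: L_eq product_vectors_def)
  have norm_g: "norm (g j) = 1" if "j \<in> {1..p}" for j
    using e_unit f_unit that by (simp add: g_def norm_tens unit_vec_iff)
  have g_L: "g j \<in> L i" if j: "j \<in> J i" for i j
  proof -
    obtain c where c: "e j = c *s e i"
      using j cline_eqD[of "e j" "e i"] by (auto simp: J_def)
    have "f j \<in> V i"
      unfolding V_def by (rule cspan_fam_base[OF finJ j])
    then have "c *s f j \<in> V i"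
      by (rule vec.subspace_scale[OF V_sub])
    then show ?thesis
      by (auto simp: g_def L_eq c tens_scale_left simp flip: tens_scale_right)
  qed
  \<comment> \<open>The generator \<open>g j\<close> uses \<open>e j\<close> while
    \<open>L i\<close> uses \<open>e i\<close>; the two are proportional, and the factors are
    absorbed into the coefficients.\<close>
  have L_span: "L i \<subseteq> cspan_fam (J i) g" for i
  proof
    fix z assume "z \<in> L i"
    then obtain c where c: "z = tens (e i) (\<Sum>j\<in>J i. c j *s f j)"
      by (auto simp: L_eq V_def cspan_fam_def)
    have "\<exists>d. e i = d *s e j" if "j \<in> J i" for j
      using that by (intro cline_eqD) (simp add: J_def)
    then obtain d where d: "\<And>j. j \<in> J i \<Longrightarrow> e i = d j *s e j" by metis
    have "z = (\<Sum>j\<in>J i. c j *s tens (e i) (f j))"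
      by (simp add: c tens_sum_right tens_scale_right)
    also have "\<dots> = (\<Sum>j\<in>J i. (c j * d j) *s g j)"
    proof (rule sum.cong)
      fix j assume "j \<in> J i"
      then have "tens (e i) (f j) = d j *s g j"
        unfolding g_def tens_scale_left[symmetric] using d by metis
      then show "c j *s tens (e i) (f j) = (c j * d j) *s g j" by simp
    qed simp
    finally show "z \<in> cspan_fam (J i) g"
      by (auto simp: cspan_fam_def)
  qed
  have Fi_gens: "{vstate (tens (e j) (f j)) | j. j \<in> {1..p} \<and> cline (e j) = cline (e i)} =
      vstate ` g ` J i" for i
    by (auto simp: g_def J_def)
  have L_face: "mixtures (L i) \<subseteq> \<Phi>"
    if "i \<in> {1..q}" "is_face \<Phi> (mixtures product_vectors)" "vstate ` g ` J i \<subseteq> \<Phi>" for i \<Phi>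
  proof (rule mixtures_subset_face[OF scale_closed_product_vectors L_sub L_prod finJ _ g_L _ L_span that(2)])
    show "J i \<noteq> {}" using iJ q_p that(1) by blast
    show "norm (g j) = 1" if "j \<in> J i" for j using that norm_g by (simp add: J_def)
    show "vstate (g j) \<in> \<Phi>" if "j \<in> J i" for j using that \<open>vstate ` g ` J i \<subseteq> \<Phi>\<close> by blast
  qed
  have Fi_eq: "Fi i = mixtures (L i)" if i: "i \<in> {1..q}" for i
    unfolding Fi_def Sst_eq_mixtures Fi_gens
  proof (rule face_gen_eqI)
    show "is_face (mixtures (L i)) (mixtures product_vectors)"
      by (rule is_face_mixtures_subspace[OF scale_closed_product_vectors L_sub L_prod])
    show "vstate ` g ` J i \<subseteq> mixtures (L i)"
      using g_L norm_g by (auto simp: J_def intro!: vstate_in_mixtures)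
  qed (use L_face i in blast)
  have "\<forall>i. \<exists>R. R \<in> bops UNIV \<and> (\<forall>j\<in>{1..p}. R (f j) = (if j \<in> J i then f j else 0))"
    using clin_indep_block_projection[OF f_indep] by metis
  then obtain R where R: "\<And>i. R i \<in> bops UNIV"
    and Rf: "\<And>i j. j \<in> {1..p} \<Longrightarrow> R i (f j) = (if j \<in> J i then f j else 0)"
    by metis
  have RV: "R i v = (if i = k then v else 0)"
    if ik: "i \<in> {1..q}" "k \<in> {1..q}" and "v \<in> V k" for i k v
  proof -
    obtain c where c: "v = (\<Sum>j\<in>J k. c j *s f j)"
      using \<open>v \<in> V k\<close> by (auto simp: V_def cspan_fam_def)
    have "R i (f j) = (if i = k then f j else 0)" if "j \<in> J k" for j
      using that ik J_disjoint[of j i k] by (subst Rf) (auto simp: J_def)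
    then have "R i v = (\<Sum>j\<in>J k. if i = k then c j *s f j else 0)"
      unfolding c bops_UNIV_simps[OF R] by (intro sum.cong) auto
    then show ?thesis
      by (simp add: c)
  qed
  have QL: "id_tens (R i) z = (if i = k then z else 0)"
    if "i \<in> {1..q}" "k \<in> {1..q}" "z \<in> L k" for i k z
    using that RV by (auto simp: L_eq id_tens_tens[OF R] tens_zero_right)
  \<comment> \<open>The span may contain entangled vectors, but its nonzero product vectors each lie
    in one block. The vector 0 is excluded because \<open>U\<close> is empty for
    \<open>q = 0\<close> while its span contains 0.\<close>
  have U_span: "product_vectors \<inter> vec.span U - {0} = U - {0}"
  proof
    show "product_vectors \<inter> vec.span U - {0} \<subseteq> U - {0}"
    proof
      fix z assume z: "z \<in> product_vectors \<inter> vec.span U - {0}"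
      then obtain a b where ab: "z = tens a b"
        by (auto simp: product_vectors_def)
      have "\<exists>i\<in>{1..q}. tens a b \<in> tens (e i) ` V i"
      proof (rule product_vector_in_span_blocks[where R = R])
        show "tens a b \<in> vec.span (\<Union>i\<in>{1..q}. tens (e i) ` V i)"
          using z by (simp add: ab U_def L_eq)
      qed (use e_dist V_sub R RV z ab in auto)
      then show "z \<in> U - {0}"
        using z by (auto simp: ab U_def L_eq)
    qed
    show "U - {0} \<subseteq> product_vectors \<inter> vec.span U - {0}"
      using L_prod vec.span_superset[of U] by (auto simp: U_def)
  qed
  then have U_mix: "mixtures (product_vectors \<inter> vec.span U) = mixtures U"
    by (metis mixtures_remove_zero)
  have F_gens: "{vstate (tens (e i) (f i)) | i. i \<in> {1..p}} = vstate ` g ` {1..p}"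
    by (auto simp: g_def)
  have U_scale: "scale_closed U"
    using subspace_scale_closed[OF L_sub] by (auto simp: U_def scale_closed_def)
  have g_U: "g j \<in> U" if "j \<in> {1..p}" for j
    using J_cover[OF that] g_L by (auto simp: U_def)
  have F_eq: "F = mixtures U"
    unfolding F_def Sst_eq_mixtures F_gens
  proof (rule face_gen_eqI)
    show "is_face (mixtures U) (mixtures product_vectors)"
      using is_face_mixtures[OF scale_closed_product_vectors vec.subspace_span, of U]
      by (simp add: U_mix)
    show "vstate ` g ` {1..p} \<subseteq> mixtures U"
      using g_U norm_g by (auto intro!: vstate_in_mixtures)
    fix \<Phi> assume \<Phi>: "is_face \<Phi> (mixtures product_vectors)" "vstate ` g ` {1..p} \<subseteq> \<Phi>"
    show "mixtures U \<subseteq> \<Phi>"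
    proof (rule mixtures_subset_fconvex[OF _ U_scale])
      show "fconvex \<Phi>" using \<Phi>(1) by (simp add: is_face_def)
      fix z assume "z \<in> U" "norm z = 1"
      then obtain i where i: "i \<in> {1..q}" "vstate z \<in> mixtures (L i)"
        unfolding U_def using vstate_in_mixtures by blast
      moreover have "vstate ` g ` J i \<subseteq> \<Phi>"
        using \<Phi>(2) by (auto simp: J_def)
      ultimately show "vstate z \<in> \<Phi>"
        using L_face[OF i(1) \<Phi>(1)] by blast
    qed
  qed
  have dcs: "direct_convex_sum F q Fi"
  proof -
    have "direct_convex_sum (mixtures U) q (\<lambda>i. mixtures (L i))"
      unfolding U_def
      by (rule direct_convex_sum_mixtures[where Q = "\<lambda>i. id_tens (R i)"])
        (use subspace_scale_closed[OF L_sub] id_tens_bops[OF R] QL in auto)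
    then show ?thesis
      using direct_convex_sum_cong[of q Fi "\<lambda>i. mixtures (L i)"] Fi_eq by (simp add: F_eq)
  qed
  have simplex: "F = fconvex_hull {vstate (tens (e i) (f i)) | i. i \<in> {1..p}} \<and> is_simplex F"
    if dist: "\<forall>i\<in>{1..p}. \<forall>j\<in>{1..p}. i \<noteq> j \<longrightarrow> cline (e i) \<noteq> cline (e j)"
  proof
    \<comment> \<open>An index beyond \<open>q\<close> would share its line with an earlier
      index.\<close>
    have "q = p"
    proof (rule ccontr)
      assume "q \<noteq> p"
      then have "p \<in> {q<..p}" using qp by simp
      then obtain j where "j \<in> {1..q}" "cline (e p) = cline (e j)"
        using e_rest by blast
      then show False
        using dist \<open>q \<noteq> p\<close> qp by (metis atLeastAtMost_iff le_antisym le_trans order_refl)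
    qed
    \<comment> \<open>Each block now holds one generator, so each \<open>L i\<close> is a line and
      each \<open>Fi i\<close> a point.\<close>
    have pt: "mixtures (L i) = {vstate (g i)}" if i: "i \<in> {1..p}" for i
    proof (rule mixtures_single_line[OF norm_g[OF i] _ g_L[OF iJ[OF i]]])
      have "J i = {i}"
        using dist i unfolding J_def by blast
      then show "L i \<subseteq> cline (g i)"
        using L_span[of i] by (force simp: cspan_fam_def cline_def)
    qed
    show "is_simplex F"
      unfolding is_simplex_def
    proof (intro exI)
      show "direct_convex_sum F p (\<lambda>i. {vstate (g i)})"
        using dcs direct_convex_sum_cong[of p Fi "\<lambda>i. {vstate (g i)}" F] Fi_eq pt \<open>q = p\<close> by simp
    qed
    show "F = fconvex_hull {vstate (tens (e i) (f i)) | i. i \<in> {1..p}}"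
      unfolding F_gens
    proof
      show "F \<subseteq> fconvex_hull (vstate ` g ` {1..p})"
        unfolding fconvex_hull_def F_eq
      proof (intro Inter_greatest)
        fix C assume "C \<in> {C. fconvex C \<and> vstate ` g ` {1..p} \<subseteq> C}"
        then have C: "fconvex C" "vstate ` g ` {1..p} \<subseteq> C" by auto
        show "mixtures U \<subseteq> C"
        proof (rule mixtures_subset_fconvex[OF C(1) U_scale])
          fix z assume "z \<in> U" "norm z = 1"
          then obtain i where "i \<in> {1..q}" "vstate z \<in> mixtures (L i)"
            unfolding U_def using vstate_in_mixtures by blast
          then show "vstate z \<in> C"
            using pt[of i] C(2) \<open>q = p\<close> by auto
        qed
      qed
      show "fconvex_hull (vstate ` g ` {1..p}) \<subseteq> F"
        unfolding fconvex_hull_def F_eq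
        using fconvex_mixtures[OF U_scale] g_U norm_g by (auto intro!: vstate_in_mixtures)
    qed
  qed
  \<comment> \<open>Since \<open>L i\<close> is linear, the product vectors may be replaced by all
    vectors as the ambient set.\<close>
  have "is_face (Fi i) Kst" if "i \<in> {1..q}" for i
    unfolding Fi_eq[OF that] Kst_def states_UNIV
    by (rule is_face_mixtures_subspace[OF _ L_sub]) (simp_all add: scale_closed_def)
  moreover have "aff_iso (Fi i) (states (L i))" if "i \<in> {1..q}" for i
    unfolding Fi_eq[OF that] by (rule aff_iso_mixtures_states[OF L_sub])
  ultimately show ?thesis
    using dcs simplex by blast
qed

end
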